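(* The Maximum $2$-Transitivity Problem can be solved in linear time for trees; that is, there is an algorithm running in linear time that, given a tree $T$, solves the problem of finding a $2$-transitive partition of $T$ with the maximum number of parts, the maximum number of parts being $Tr_2(T)$.
   Context: Graphs are finite, simple and undirected. For disjoint $A,B\subseteq V$, $A$ $2$-dominates $B$ if every vertex of $B$ is adjacent to at least two vertices of $A$. A $2$-transitive partition of size $k$ of $G=(V,E)$ is a partition $\{V_1,\ldots,V_k\}$ of $V$ into $k$ nonempty (ordered) parts such that $V_i$ $2$-dominates $V_j$ for all $1\leq i<j\leq k$. The $2$-transitivity $Tr_2(G)$ is the maximum size of a $2$-transitive partition of $G$. The Maximum $2$-Transitivity Problem is: given a graph $G$, find a $2$-transitive partition of $G$ of maximum order. Linear time means $O(|V|+|E|)$. *)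

theory Defs
  imports "HOL-Library.Disjoint_Sets"
begin

text \<open>A graph is given by a vertex set and a set of two-element edge sets.\<close>

definition simple_graph :: "'a set \<Rightarrow> 'a set set \<Rightarrow> bool" where
  "simple_graph V E \<longleftrightarrow> finite V \<and> (\<forall>e\<in>E. e \<subseteq> V \<and> card e = 2)"

definition connected_graph :: "'a set \<Rightarrow> 'a set set \<Rightarrow> bool" where
  "connected_graph V E \<longleftrightarrow> V \<noteq> {} \<and> (\<forall>u\<in>V. \<forall>v\<in>V. (u, v) \<in> {(x, y). {x, y} \<in> E}\<^sup>*)"

definition graph_cycle :: "'a set set \<Rightarrow> 'a list \<Rightarrow> bool" where
  "graph_cycle E c \<longleftrightarrow>
     3 \<le> length c \<and> distinct c \<and> (\<forall>i<length c. {c ! i, c ! (Suc i mod length c)} \<in> E)"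

definition tree :: "'a set \<Rightarrow> 'a set set \<Rightarrow> bool" where
  "tree V E \<longleftrightarrow> simple_graph V E \<and> connected_graph V E \<and> \<not> (\<exists>c. graph_cycle E c)"

definition two_dominates :: "'a set set \<Rightarrow> 'a set \<Rightarrow> 'a set \<Rightarrow> bool" where
  "two_dominates E A B \<longleftrightarrow> (\<forall>v\<in>B. 2 \<le> card {u \<in> A. {u, v} \<in> E})"

text \<open>The ordered partition is the list of its parts; \<open>partition_on\<close> makes the parts
  nonempty, disjoint and covering, and \<open>distinct\<close> excludes listing a part twice.\<close>

definition two_transitive_partition :: "'a set \<Rightarrow> 'a set set \<Rightarrow> 'a set list \<Rightarrow> bool" where
  "two_transitive_partition V E P \<longleftrightarrow>
     distinct P \<and> partition_on V (set P) \<and>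
     (\<forall>i j. i < j \<and> j < length P \<longrightarrow> two_dominates E (P ! i) (P ! j))"

definition Tr2 :: "'a set \<Rightarrow> 'a set set \<Rightarrow> nat" where
  "Tr2 V E = Max {length P |P. two_transitive_partition V E P}"

definition maximum_two_transitive_partition :: "'a set \<Rightarrow> 'a set set \<Rightarrow> 'a set list \<Rightarrow> bool" where
  "maximum_two_transitive_partition V E P \<longleftrightarrow>
     two_transitive_partition V E P \<and>
     (\<forall>Q. two_transitive_partition V E Q \<longrightarrow> length Q \<le> length P)"

text \<open>
  Programs of a unit-cost word RAM. A program has finitely many registers and finitely many
  arrays (those it names), all initially zero outside the input. Arrays are addressed
  indirectly. The only arithmetic is addition and truncated subtraction; every elementary
  instruction and every evaluation of a condition takes one time unit.
\<close>

datatype operand = Const nat | Reg nat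

datatype cond = Less operand operand | Equal operand operand

datatype com =
    Skip
  | Assign nat operand
  | Add nat operand operand
  | Sub nat operand operand
  | Load nat nat operand          \<comment> \<open>\<open>Load x a i\<close>: register \<open>x\<close> receives cell \<open>i\<close> of array \<open>a\<close>\<close>
  | Store nat operand operand     \<comment> \<open>\<open>Store a i v\<close>: cell \<open>i\<close> of array \<open>a\<close> receives \<open>v\<close>\<close>
  | Seq com com
  | Cond cond com com
  | While cond com

record state =
  reg :: "nat \<Rightarrow> nat"
  arr :: "nat \<Rightarrow> nat \<Rightarrow> nat"

fun opval :: "operand \<Rightarrow> state \<Rightarrow> nat" where
  "opval (Const k) s = k"
| "opval (Reg x) s = reg s x"

fun holds :: "cond \<Rightarrow> state \<Rightarrow> bool" where
  "holds (Less a b) s \<longleftrightarrow> opval a s < opval b s"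
| "holds (Equal a b) s \<longleftrightarrow> opval a s = opval b s"

definition set_reg :: "nat \<Rightarrow> nat \<Rightarrow> state \<Rightarrow> state" where
  "set_reg x v s = s\<lparr>reg := (reg s)(x := v)\<rparr>"

definition set_arr :: "nat \<Rightarrow> nat \<Rightarrow> nat \<Rightarrow> state \<Rightarrow> state" where
  "set_arr a i v s = s\<lparr>arr := (arr s)(a := (arr s a)(i := v))\<rparr>"

text \<open>
  \<open>exec W p s t s'\<close>: started in \<open>s\<close>, the program \<open>p\<close> terminates in \<open>s'\<close> after exactly \<open>t\<close>
  time units. \<open>W\<close> is the largest number that fits into a machine word: an instruction
  writing a larger number is stuck, so an existing run never overflows.
\<close>

inductive exec :: "nat \<Rightarrow> com \<Rightarrow> state \<Rightarrow> nat \<Rightarrow> state \<Rightarrow> bool" for W where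
  Skip: "exec W Skip s 1 s"
| Assign: "opval a s \<le> W \<Longrightarrow> exec W (Assign x a) s 1 (set_reg x (opval a s) s)"
| Add: "opval a s + opval b s \<le> W \<Longrightarrow>
    exec W (Add x a b) s 1 (set_reg x (opval a s + opval b s) s)"
| Sub: "opval a s - opval b s \<le> W \<Longrightarrow>
    exec W (Sub x a b) s 1 (set_reg x (opval a s - opval b s) s)"
| Load: "arr s a (opval i s) \<le> W \<Longrightarrow>
    exec W (Load x a i) s 1 (set_reg x (arr s a (opval i s)) s)"
| Store: "opval v s \<le> W \<Longrightarrow>
    exec W (Store a i v) s 1 (set_arr a (opval i s) (opval v s) s)"
| Seq: "exec W p s t s' \<Longrightarrow> exec W q s' t' s'' \<Longrightarrow> exec W (Seq p q) s (t + t') s''"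
| IfTrue: "holds b s \<Longrightarrow> exec W p s t s' \<Longrightarrow> exec W (Cond b p q) s (t + 1) s'"
| IfFalse: "\<not> holds b s \<Longrightarrow> exec W q s t s' \<Longrightarrow> exec W (Cond b p q) s (t + 1) s'"
| WhileFalse: "\<not> holds b s \<Longrightarrow> exec W (While b p) s 1 s"
| WhileTrue: "holds b s \<Longrightarrow> exec W p s t s' \<Longrightarrow> exec W (While b p) s' t' s'' \<Longrightarrow>
    exec W (While b p) s (t + t' + 1) s''"

text \<open>The existence of a run is a statement about the only possible run:\<close>

inductive_cases exec_SkipE: "exec W Skip s t s'"
inductive_cases exec_AssignE: "exec W (Assign x a) s t s'"
inductive_cases exec_AddE: "exec W (Add x a b) s t s'"
inductive_cases exec_SubE: "exec W (Sub x a b) s t s'"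
inductive_cases exec_LoadE: "exec W (Load x a i) s t s'"
inductive_cases exec_StoreE: "exec W (Store a i v) s t s'"
inductive_cases exec_SeqE: "exec W (Seq p q) s t s'"
inductive_cases exec_IfE: "exec W (Cond b p q) s t s'"
inductive_cases exec_WhileE: "exec W (While b p) s t s'"

lemma exec_deterministic:
  "exec W p s t s' \<Longrightarrow> exec W p s u s'' \<Longrightarrow> u = t \<and> s'' = s'"
proof (induction arbitrary: u s'' rule: exec.induct)
  case (Skip s)
  from Skip.prems show ?case by (rule exec_SkipE) simp
next
  case (Assign a s x)
  from Assign.prems show ?case by (rule exec_AssignE) simp
next
  case (Add a s b x)
  from Add.prems show ?case by (rule exec_AddE) simp
next
  case (Sub a s b x)
  from Sub.prems show ?case by (rule exec_SubE) simp
next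
  case (Load s a i x)
  from Load.prems show ?case by (rule exec_LoadE) simp
next
  case (Store v s a i)
  from Store.prems show ?case by (rule exec_StoreE) simp
next
  case (Seq p s t s' q t' r)
  from Seq.prems show ?case by (rule exec_SeqE) (metis Seq.IH)
next
  case (IfTrue b s p t s' q)
  from IfTrue.prems show ?case by (rule exec_IfE) (use IfTrue.hyps(1) in \<open>auto dest: IfTrue.IH\<close>)
next
  case (IfFalse b s q t s' p)
  from IfFalse.prems show ?case by (rule exec_IfE) (use IfFalse.hyps(1) in \<open>auto dest: IfFalse.IH\<close>)
next
  case (WhileFalse b s p)
  from WhileFalse.prems show ?case by (rule exec_WhileE) (use WhileFalse.hyps in auto)
next
  case (WhileTrue b s p t s' t' r)
  from WhileTrue.prems show ?case
    by (rule exec_WhileE) (use WhileTrue.hyps(1) in \<open>auto dest!: WhileTrue.IH\<close>)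
qed

text \<open>
  The vertices are numbered \<open>0, \<dots>, length vs - 1\<close> by an enumeration \<open>vs\<close>, and \<open>adj ! i\<close>
  lists the numbers of the neighbours of vertex \<open>i\<close>, in any order.
\<close>

definition adjacency_lists :: "'a set \<Rightarrow> 'a set set \<Rightarrow> 'a list \<Rightarrow> nat list list \<Rightarrow> bool" where
  "adjacency_lists V E vs adj \<longleftrightarrow>
     distinct vs \<and> set vs = V \<and> length adj = length vs \<and>
     (\<forall>i<length vs. distinct (adj ! i) \<and>
        set (adj ! i) = {j. j < length vs \<and> {vs ! i, vs ! j} \<in> E})"

text \<open>
  Register 0 holds the number of vertices. Array 1 is the concatenation of the adjacency
  lists, and the list of vertex \<open>i\<close> occupies the cells from \<open>arr s 0 i\<close> (inclusive) to
  \<open>arr s 0 (i + 1)\<close> (exclusive) of it.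
\<close>

definition input_state :: "nat list list \<Rightarrow> state" where
  "input_state adj = \<lparr>
     reg = (\<lambda>x. if x = 0 then length adj else 0),
     arr = (\<lambda>a i.
       if a = 0 \<and> i \<le> length adj then length (concat (take i adj))
       else if a = 1 \<and> i < length (concat adj) then concat adj ! i
       else 0)\<rparr>"

text \<open>Register 1 holds the number of parts, and cell \<open>i\<close> of array 2 the index, counted from 0,
  of the part containing vertex \<open>i\<close>.\<close>

definition output_partition :: "'a list \<Rightarrow> state \<Rightarrow> 'a set list" where
  "output_partition vs s =
     map (\<lambda>j. {vs ! i |i. i < length vs \<and> arr s 2 i = j}) [0..<reg s 1]"

end

theory Submission
  imports Defs
begin

text \<open>
  Number the parts from 0 and read a partition as a labelling of the vertices: a vertex with
  label \<open>k\<close> needs two neighbours of every label below \<open>k\<close>. A vertex with label 0 needs nothing,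
  so a labelling of part of the tree in which all demands are met extends to the whole tree by
  zeros, and the problem is to find the largest label that a single vertex can carry.

  Root the tree at a vertex with the largest label \<open>k\<close>. Every other vertex that is involved
  serves its parent, and its own label is smaller than that of the parent, so its own demands are
  met by its remaining neighbours. This suggests the following notion, which does not mention a
  root: every vertex is robust at level 0, and \<open>p\<close> is robust at level \<open>k\<close> if, for each \<open>j < k\<close>, at
  least \<open>2 * (k - j) + 1\<close> of its neighbours are robust at level \<open>j\<close>. The summand 1 pays for the
  neighbour that is lost to the role of parent. A vertex can carry label \<open>k\<close>, with no parent to
  serve, exactly if it has \<open>2 * (k - j)\<close> neighbours robust at each level \<open>j < k\<close> (\<open>attains\<close>).
  That this is necessary holds in every graph (\<open>labelled_attains\<close>): a neighbour of larger label
  is itself robust at the level in question and supplies the summand 1. That it is sufficient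
  uses that the graph is acyclic: hand out labels from the root downwards, giving the labels
  \<open>l - 1, l - 1, \<dots>, 0, 0\<close> to the neighbours other than the parent of a vertex with label \<open>l\<close>,
  the most robust ones first. The counts say that each of them is robust at the level of its
  label, and acyclicity says that no vertex is reached twice (\<open>partial_labelling_step\<close>).

  Both halves run in linear time without sorting. The robust vertices of level \<open>k + 1\<close> arise
  from those of level \<open>k\<close> by deleting vertices, so one counter per vertex suffices: it is
  decremented once for each neighbour that is deleted. A vertex takes part in level \<open>k\<close> only if
  its degree is at least \<open>2 * k\<close>, so the scans of all levels cost no more than the sum of the
  degrees (\<open>level_loop\<close>). The order of deletion is an order of increasing robustness; if every
  deleted vertex enters itself into a block of each of its neighbours, filled from the right,
  then the block of every vertex ends up sorted by decreasing robustness, which is the order in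
  which the second half wants it (\<open>queue_loop\<close>).
\<close>

section \<open>Robust vertices and attainable labels\<close>

fun robust :: "('v \<Rightarrow> 'v set) \<Rightarrow> nat \<Rightarrow> 'v \<Rightarrow> bool" where
  "robust N k p \<longleftrightarrow> (\<forall>j<k. 2 * (k - j) + 1 \<le> card {q \<in> N p. robust N j q})"

declare robust.simps [simp del]

definition attains :: "('v \<Rightarrow> 'v set) \<Rightarrow> nat \<Rightarrow> 'v \<Rightarrow> bool" where
  "attains N k v \<longleftrightarrow> (\<forall>j<k. 2 * (k - j) \<le> card {q \<in> N v. robust N j q})"

definition two_transitive_labelling :: "'v set \<Rightarrow> ('v \<Rightarrow> 'v set) \<Rightarrow> ('v \<Rightarrow> nat) \<Rightarrow> bool" where
  "two_transitive_labelling V N f \<longleftrightarrow> (\<forall>u\<in>V. \<forall>i<f u. 2 \<le> card {c \<in> N u. f c = i})"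

lemma robustD: "robust N k p \<Longrightarrow> j < k \<Longrightarrow> 2 * (k - j) + 1 \<le> card {q \<in> N p. robust N j q}"
  by (rule iffD1[OF robust.simps, THEN spec, THEN mp])

lemma robustI:
  "(\<And>j. j < k \<Longrightarrow> 2 * (k - j) + 1 \<le> card {q \<in> N p. robust N j q}) \<Longrightarrow> robust N k p"
  by (rule iffD2[OF robust.simps]) blast

lemma robust_0 [simp]: "robust N 0 p"
  by (rule robustI) simp

lemma robust_antimono: "robust N k p \<Longrightarrow> j \<le> k \<Longrightarrow> robust N j p"
proof (rule robustI)
  fix i assume "robust N k p" "j \<le> k" "i < j"
  then have "2 * (k - i) + 1 \<le> card {q \<in> N p. robust N i q}" by (intro robustD) simp_all
  with \<open>j \<le> k\<close> show "2 * (j - i) + 1 \<le> card {q \<in> N p. robust N i q}" by linarith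
qed

lemma robust_degree: "robust N k p \<Longrightarrow> finite (N p) \<Longrightarrow> 2 * k \<le> card (N p)"
proof -
  assume a: "robust N k p" "finite (N p)"
  show ?thesis
  proof (cases "k = 0")
    case False
    then have "2 * (k - 0) + 1 \<le> card {q \<in> N p. robust N 0 q}"
      using a(1) by (intro robustD) simp_all
    then show ?thesis by simp
  qed simp
qed

lemma attains_Suc_robust: "attains N (Suc k) v \<Longrightarrow> robust N k v"
proof (rule robustI)
  fix j assume "attains N (Suc k) v" "j < k"
  then have "2 * (Suc k - j) \<le> card {q \<in> N v. robust N j q}"
    unfolding attains_def by (elim allE[of _ j]) simp
  with \<open>j < k\<close> show "2 * (k - j) + 1 \<le> card {q \<in> N v. robust N j q}" by linarith
qed

text \<open>Two elements for each of the \<open>m - j\<close> labels, and the classes of different labels are disjoint.\<close>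
lemma card_labels_ge:
  assumes "finite A" "\<And>i. j \<le> i \<Longrightarrow> i < m \<Longrightarrow> 2 \<le> card {c \<in> A. f c = (i::nat)}"
  shows "2 * (m - j) \<le> card {c \<in> A. j \<le> f c \<and> f c < m}"
  using assms(2)
proof (induction m)
  case (Suc m)
  show ?case
  proof (cases "j \<le> m")
    case True
    have eq: "{c \<in> A. j \<le> f c \<and> f c < Suc m} = {c \<in> A. j \<le> f c \<and> f c < m} \<union> {c \<in> A. f c = m}"
      using True by auto
    have "card {c \<in> A. j \<le> f c \<and> f c < Suc m}
        = card {c \<in> A. j \<le> f c \<and> f c < m} + card {c \<in> A. f c = m}"
      unfolding eq by (rule card_Un_disjoint) (use assms(1) in auto)
    moreover have "2 * (m - j) \<le> card {c \<in> A. j \<le> f c \<and> f c < m}" using Suc by simp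
    moreover have "2 \<le> card {c \<in> A. f c = m}" using Suc True by simp
    ultimately show ?thesis using True by simp
  qed simp
qed simp

text \<open>
  The two cases of the premise support each other in the induction. A vertex of label \<open>i\<close> counts
  its neighbours with labels in \<open>{j..<i}\<close>, which all have it as a neighbour of larger label, and in
  addition the neighbour of larger label given by the premise. A vertex of larger label has even
  two further neighbours, namely those of label \<open>i\<close>.
\<close>
lemma labelled_robust:
  assumes "two_transitive_labelling V N f" "\<And>u. u \<in> V \<Longrightarrow> N u \<subseteq> V" "\<And>u. u \<in> V \<Longrightarrow> finite (N u)"
    and "\<And>u v. u \<in> V \<Longrightarrow> v \<in> N u \<Longrightarrow> u \<in> N v"
    and "p \<in> V" "f p > i \<or> (f p = i \<and> (\<exists>v\<in>N p. f v > i))"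
  shows "robust N i p"
  using assms(5,6)
proof (induction i arbitrary: p rule: less_induct)
  case (less i)
  have lower: "robust N j c" if "c \<in> N p" "j < i" "j \<le> f c" "f c < f p" "f c \<le> i" for j c
  proof (rule less.IH)
    show "c \<in> V" using that assms(2) less.prems by blast
    have "p \<in> N c" using that assms(4) less.prems by blast
    then show "j < f c \<or> f c = j \<and> (\<exists>v\<in>N c. j < f v)" using that by fastforce
  qed fact
  have two: "2 \<le> card {c \<in> N p. f c = l}" if "l < f p" for l
    using assms(1) less.prems(1) that unfolding two_transitive_labelling_def by blast
  have fin: "finite (N p)" using assms(3) less.prems by blast
  show ?case
  proof (rule robustI)
    fix j assume j: "j < i"
    from less.prems(2) show "2 * (i - j) + 1 \<le> card {q \<in> N p. robust N j q}"
    proof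
      assume "i < f p"
      then have "2 * (Suc i - j) \<le> card {c \<in> N p. j \<le> f c \<and> f c < Suc i}"
        by (intro card_labels_ge fin two) auto
      also have "\<dots> \<le> card {q \<in> N p. robust N j q}"
        using lower j \<open>i < f p\<close> by (intro card_mono) (use fin in auto)
      finally show ?thesis using j by simp
    next
      assume "f p = i \<and> (\<exists>v\<in>N p. i < f v)"
      then obtain v where v: "f p = i" "v \<in> N p" "i < f v" by blast
      have "robust N j v"
        using v j assms(2) less.prems(1) by (intro less.IH) auto
      then have sub: "insert v {c \<in> N p. j \<le> f c \<and> f c < i} \<subseteq> {q \<in> N p. robust N j q}"
        using lower j v by auto
      have "2 * (i - j) \<le> card {c \<in> N p. j \<le> f c \<and> f c < i}"
        by (intro card_labels_ge fin two) (use v in auto)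
      then have "2 * (i - j) + 1 \<le> card (insert v {c \<in> N p. j \<le> f c \<and> f c < i})"
        using fin v by simp
      also have "\<dots> \<le> card {q \<in> N p. robust N j q}"
        using sub fin by (intro card_mono) auto
      finally show ?thesis .
    qed
  qed
qed

text \<open>
  The upper bound on all labels. The neighbours of \<open>v\<close> with smaller labels see \<open>v\<close> as a neighbour
  of larger label, so they are robust at the level of their label.
\<close>
lemma labelled_attains:
  assumes "two_transitive_labelling V N f" "\<And>u. u \<in> V \<Longrightarrow> N u \<subseteq> V" "\<And>u. u \<in> V \<Longrightarrow> finite (N u)"
    and "\<And>u v. u \<in> V \<Longrightarrow> v \<in> N u \<Longrightarrow> u \<in> N v" and "v \<in> V"
  shows "attains N (f v) v"
  unfolding attains_def
proof (intro allI impI)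
  fix j assume j: "j < f v"
  have fin: "finite (N v)" using assms by blast
  have "2 * (f v - j) \<le> card {c \<in> N v. j \<le> f c \<and> f c < f v}"
    using assms(1,5) fin by (intro card_labels_ge) (auto simp: two_transitive_labelling_def)
  also have "\<dots> \<le> card {q \<in> N v. robust N j q}"
  proof (rule card_mono, use fin in simp, clarify)
    fix c assume c: "c \<in> N v" "j \<le> f c" "f c < f v"
    have "robust N (f c) c"
    proof (rule labelled_robust[OF assms(1-4)])
      show "c \<in> V" using assms(2)[OF assms(5)] c(1) by blast
      show "f c < f c \<or> f c = f c \<and> (\<exists>v\<in>N c. f c < f v)"
        using assms(4)[OF assms(5) c(1)] c(3) by blast
    qed
    then show "robust N j c" using c(2) by (rule robust_antimono)
  qed
  finally show "2 * (f v - j) \<le> card {q \<in> N v. robust N j q}" .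
qed

section \<open>Cutting an edge of an acyclic graph\<close>

text \<open>A shortest detour around the edge repeats no vertex, so the edge closes it to a cycle.\<close>
lemma acyclic_edge_separates:
  assumes "simple_graph V E" "\<not> (\<exists>c. graph_cycle E c)" "{u, v} \<in> E"
  shows "(u, v) \<notin> {(x, y). {x, y} \<in> E \<and> {x, y} \<noteq> {u, v}}\<^sup>*"
proof
  let ?R = "{(x, y). {x, y} \<in> E \<and> {x, y} \<noteq> {u, v}}"
  assume "(u, v) \<in> ?R\<^sup>*"
  then have ex: "\<exists>n. (u, v) \<in> ?R ^^ n" by (simp add: rtrancl_power)
  define n where "n = (LEAST n. (u, v) \<in> ?R ^^ n)"
  have n: "(u, v) \<in> ?R ^^ n" unfolding n_def using ex by (rule LeastI_ex)
  have least: "n \<le> m" if "(u, v) \<in> ?R ^^ m" for m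
    unfolding n_def using that by (rule Least_le)
  obtain f where f: "f 0 = u" "f n = v" "\<And>i. i < n \<Longrightarrow> (f i, f (Suc i)) \<in> ?R"
    using n by (auto simp: relpow_fun_conv)
  have uv: "u \<noteq> v" using assms(1,3) by (force simp: simple_graph_def)
  have walk: "(f i, f (i + d)) \<in> ?R ^^ d" if "i + d \<le> n" for i d
    unfolding relpow_fun_conv using that f(3) by (intro exI[of _ "\<lambda>k. f (i + k)"]) auto
  have inj: "f i \<noteq> f j" if "i < j" "j \<le> n" for i j
  proof
    assume eq: "f i = f j"
    have "(u, f i) \<in> ?R ^^ i" using walk[of 0 i] that f(1) by simp
    moreover have "(f j, v) \<in> ?R ^^ (n - j)" using walk[of j "n - j"] that f(2) by simp
    ultimately have "(u, v) \<in> ?R ^^ (i + (n - j))" using eq by (auto simp: relpow_add)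
    from least[OF this] show False using that by simp
  qed
  have "n \<noteq> 0" using f(1,2) uv by (intro notI) simp
  moreover have "n \<noteq> 1" using f(1,2) f(3)[of 0] by auto
  ultimately have n2: "2 \<le> n" by simp
  have "graph_cycle E (map f [0..<Suc n])"
    unfolding graph_cycle_def
  proof (intro conjI allI impI)
    show "3 \<le> length (map f [0..<Suc n])" using n2 by simp
    show "distinct (map f [0..<Suc n])"
      unfolding distinct_map
    proof (intro conjI inj_onI)
      fix x y assume "x \<in> set [0..<Suc n]" "y \<in> set [0..<Suc n]" "f x = f y"
      then show "x = y" using inj[of x y] inj[of y x] by (cases x y rule: linorder_cases) auto
    qed simp
    fix i assume i: "i < length (map f [0..<Suc n])"
    show "{map f [0..<Suc n] ! i, map f [0..<Suc n] ! (Suc i mod length (map f [0..<Suc n]))} \<in> E"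
    proof (cases "i = n")
      case True
      then show ?thesis using f assms(3) by (simp del: upt_Suc add: insert_commute)
    next
      case False
      then show ?thesis using i f(3)[of i] by (simp del: upt_Suc)
    qed
  qed
  then show False using assms(2) by blast
qed

section \<open>Runs within a time budget\<close>

text \<open>
  A weakest precondition for total correctness in which the state is accompanied by the time
  \<open>\<tau>\<close> that is still available. Paying for each instruction from this budget makes time bounds
  compose like assertions, and loop invariants may speak about the remaining budget.
\<close>
definition wp :: "nat \<Rightarrow> com \<Rightarrow> (nat \<Rightarrow> state \<Rightarrow> bool) \<Rightarrow> nat \<Rightarrow> state \<Rightarrow> bool" where
  "wp W p Q \<tau> s \<longleftrightarrow> (\<exists>t s'. exec W p s t s' \<and> t \<le> \<tau> \<and> Q (\<tau> - t) s')"

lemma wpI: "exec W p s t s' \<Longrightarrow> t \<le> \<tau> \<Longrightarrow> Q (\<tau> - t) s' \<Longrightarrow> wp W p Q \<tau> s"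
  unfolding wp_def by blast

lemma wpE:
  assumes "wp W p Q \<tau> s"
  obtains t s' where "exec W p s t s'" "t \<le> \<tau>" "Q (\<tau> - t) s'"
  using assms unfolding wp_def by blast

lemma wp_atomic:
  assumes "\<And>t s''. exec W p s t s'' \<longleftrightarrow> P \<and> t = 1 \<and> s'' = s'"
  shows "wp W p Q \<tau> s \<longleftrightarrow> P \<and> 1 \<le> \<tau> \<and> Q (\<tau> - 1) s'"
  unfolding wp_def assms by blast

lemma wp_Skip [simp]: "wp W Skip Q \<tau> s \<longleftrightarrow> 1 \<le> \<tau> \<and> Q (\<tau> - 1) s"
  by (subst wp_atomic[where P = True and s' = s]) (auto elim: exec_SkipE intro: exec.Skip simp del: One_nat_def)

lemma wp_Assign [simp]: "wp W (Assign x a) Q \<tau> s \<longleftrightarrow>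
    opval a s \<le> W \<and> 1 \<le> \<tau> \<and> Q (\<tau> - 1) (set_reg x (opval a s) s)"
  by (rule wp_atomic, rule iffI, (auto elim: exec_AssignE)[1], elim conjE, hypsubst, erule exec.Assign)

lemma wp_Add [simp]: "wp W (Add x a b) Q \<tau> s \<longleftrightarrow>
    opval a s + opval b s \<le> W \<and> 1 \<le> \<tau> \<and> Q (\<tau> - 1) (set_reg x (opval a s + opval b s) s)"
  by (rule wp_atomic, rule iffI, (auto elim: exec_AddE)[1], elim conjE, hypsubst, erule exec.Add)

lemma wp_Sub [simp]: "wp W (Sub x a b) Q \<tau> s \<longleftrightarrow>
    opval a s - opval b s \<le> W \<and> 1 \<le> \<tau> \<and> Q (\<tau> - 1) (set_reg x (opval a s - opval b s) s)"
  by (rule wp_atomic, rule iffI, (auto elim: exec_SubE)[1], elim conjE, hypsubst, erule exec.Sub)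

lemma wp_Load [simp]: "wp W (Load x a i) Q \<tau> s \<longleftrightarrow>
    arr s a (opval i s) \<le> W \<and> 1 \<le> \<tau> \<and> Q (\<tau> - 1) (set_reg x (arr s a (opval i s)) s)"
  by (rule wp_atomic, rule iffI, (auto elim: exec_LoadE)[1], elim conjE, hypsubst, erule exec.Load)

lemma wp_Store [simp]: "wp W (Store a i v) Q \<tau> s \<longleftrightarrow>
    opval v s \<le> W \<and> 1 \<le> \<tau> \<and> Q (\<tau> - 1) (set_arr a (opval i s) (opval v s) s)"
  by (rule wp_atomic, rule iffI, (auto elim: exec_StoreE)[1], elim conjE, hypsubst, erule exec.Store)

lemma wp_Seq [simp]: "wp W (Seq p q) Q \<tau> s \<longleftrightarrow> wp W p (wp W q Q) \<tau> s"
proof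
  assume "wp W (Seq p q) Q \<tau> s"
  then obtain u s'' where u: "exec W (Seq p q) s u s''" "u \<le> \<tau>" "Q (\<tau> - u) s''" by (rule wpE)
  from u(1) obtain t s' t' where e: "u = t + t'" "exec W p s t s'" "exec W q s' t' s''"
    by (rule exec_SeqE)
  have "wp W q Q (\<tau> - t) s'" using e(3) by (rule wpI) (use e(1) u in simp_all)
  then show "wp W p (wp W q Q) \<tau> s" by (intro wpI[OF e(2)]) (use e(1) u in simp_all)
next
  assume "wp W p (wp W q Q) \<tau> s"
  then obtain t s' where t: "exec W p s t s'" "t \<le> \<tau>" "wp W q Q (\<tau> - t) s'" by (rule wpE)
  from t(3) obtain t' s'' where t': "exec W q s' t' s''" "t' \<le> \<tau> - t" "Q (\<tau> - t - t') s''"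
    by (rule wpE)
  from t(1) t'(1) have "exec W (Seq p q) s (t + t') s''" by (rule exec.Seq)
  then show "wp W (Seq p q) Q \<tau> s" by (rule wpI) (use t t' in simp_all)
qed

lemma wp_Cond [simp]: "wp W (Cond b p q) Q \<tau> s \<longleftrightarrow>
    1 \<le> \<tau> \<and> (if holds b s then wp W p Q (\<tau> - 1) s else wp W q Q (\<tau> - 1) s)"
proof -
  have run: "exec W (Cond b p q) s u s' \<longleftrightarrow>
      (\<exists>t. u = t + 1 \<and> exec W (if holds b s then p else q) s t s')" for u s'
    by (rule iffI, erule exec_IfE) (auto split: if_splits dest: exec.IfTrue exec.IfFalse)
  have "wp W (Cond b p q) Q \<tau> s \<longleftrightarrow> 1 \<le> \<tau> \<and> wp W (if holds b s then p else q) Q (\<tau> - 1) s"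
  proof (intro iffI conjI; (elim conjE)?)
    assume "wp W (Cond b p q) Q \<tau> s"
    then obtain u s' where "exec W (Cond b p q) s u s'" "u \<le> \<tau>" "Q (\<tau> - u) s'" by (rule wpE)
    then obtain t where t: "exec W (if holds b s then p else q) s t s'" "t + 1 \<le> \<tau>"
        "Q (\<tau> - (t + 1)) s'"
      unfolding run by blast
    show "1 \<le> \<tau>" using t(2) by simp
    from t(1) show "wp W (if holds b s then p else q) Q (\<tau> - 1) s"
      by (rule wpI) (use t in simp_all)
  next
    assume "1 \<le> \<tau>" "wp W (if holds b s then p else q) Q (\<tau> - 1) s"
    from this(2) obtain t s' where t: "exec W (if holds b s then p else q) s t s'" "t \<le> \<tau> - 1"
        "Q (\<tau> - 1 - t) s'" by (rule wpE)
    from t(1) have "exec W (Cond b p q) s (t + 1) s'" unfolding run by blast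
    then show "wp W (Cond b p q) Q \<tau> s" by (rule wpI) (use t \<open>1 \<le> \<tau>\<close> in simp_all)
  qed
  then show ?thesis by simp
qed

lemma wp_mono: "wp W p Q \<tau> s \<Longrightarrow> (\<And>\<tau> s. Q \<tau> s \<Longrightarrow> Q' \<tau> s) \<Longrightarrow> wp W p Q' \<tau> s"
  unfolding wp_def by blast

text \<open>
  Each iteration consumes budget, so the budget also is the termination measure: an invariant
  that always leaves at least one time unit bounds the number of iterations.
\<close>
lemma wp_While:
  assumes "I \<tau> s"
    and "\<And>\<tau> s. I \<tau> s \<Longrightarrow> 1 \<le> \<tau>"
    and "\<And>\<tau> s. I \<tau> s \<Longrightarrow> holds b s \<Longrightarrow> wp W p I (\<tau> - 1) s"
    and "\<And>\<tau> s. I \<tau> s \<Longrightarrow> \<not> holds b s \<Longrightarrow> Q (\<tau> - 1) s"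
  shows "wp W (While b p) Q \<tau> s"
  using assms(1)
proof (induction \<tau> arbitrary: s rule: less_induct)
  case (less \<tau>)
  have pos: "1 \<le> \<tau>" using assms(2) less.prems by blast
  show ?case
  proof (cases "holds b s")
    case False
    show ?thesis
      using exec.WhileFalse[OF False] pos assms(4)[OF less.prems False] by (rule wpI)
  next
    case True
    from assms(3)[OF less.prems True] obtain t s' where
      b: "exec W p s t s'" "t \<le> \<tau> - 1" "I (\<tau> - 1 - t) s'" by (rule wpE)
    have "\<tau> - 1 - t < \<tau>" using pos by simp
    from less.IH[OF this b(3)] obtain t' s'' where
      r: "exec W (While b p) s' t' s''" "t' \<le> \<tau> - 1 - t" "Q (\<tau> - 1 - t - t') s''" by (rule wpE)
    have "exec W (While b p) s (t + t' + 1) s''" using True b(1) r(1) by (rule exec.WhileTrue)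
    then show ?thesis by (rule wpI) (use pos b(2) r(2,3) in simp_all)
  qed
qed

lemma reg_set_reg [simp]: "reg (set_reg x v s) y = (if y = x then v else reg s y)"
  by (simp add: set_reg_def)

lemma arr_set_reg [simp]: "arr (set_reg x v s) = arr s"
  by (simp add: set_reg_def)

lemma reg_set_arr [simp]: "reg (set_arr a i v s) = reg s"
  by (simp add: set_arr_def)

lemma arr_set_arr [simp]: "arr (set_arr a i v s) b = (if b = a then (arr s a)(i := v) else arr s b)"
  by (simp add: set_arr_def)

text \<open>The frame of a loop: outside the registers \<open>X\<close> and the arrays \<open>Y\<close> nothing has changed.\<close>
definition agree :: "nat set \<Rightarrow> nat set \<Rightarrow> state \<Rightarrow> state \<Rightarrow> bool" where
  "agree X Y s s' \<longleftrightarrow> (\<forall>x. x \<notin> X \<longrightarrow> reg s' x = reg s x) \<and> (\<forall>a. a \<notin> Y \<longrightarrow> arr s' a = arr s a)"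

lemma agree_refl [simp]: "agree X Y s s"
  by (simp add: agree_def)

lemma agree_set_reg [simp]: "x \<in> X \<Longrightarrow> agree X Y s (set_reg x v s') \<longleftrightarrow> agree X Y s s'"
  by (auto simp: agree_def)

lemma agree_set_arr [simp]: "a \<in> Y \<Longrightarrow> agree X Y s (set_arr a i v s') \<longleftrightarrow> agree X Y s s'"
  by (auto simp: agree_def)

lemma agree_reg: "agree X Y s s' \<Longrightarrow> x \<notin> X \<Longrightarrow> reg s' x = reg s x"
  by (simp add: agree_def)

lemma agree_arr: "agree X Y s s' \<Longrightarrow> a \<notin> Y \<Longrightarrow> arr s' a = arr s a"
  by (simp add: agree_def)

lemma agree_trans:
  "agree X Y s s' \<Longrightarrow> agree X' Y' s' s'' \<Longrightarrow> X \<subseteq> X'' \<Longrightarrow> X' \<subseteq> X'' \<Longrightarrow> Y \<subseteq> Y'' \<Longrightarrow> Y' \<subseteq> Y'' \<Longrightarrow>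
    agree X'' Y'' s s''"
  unfolding agree_def by (metis subsetD)

text \<open>An array, or part of it, seen as a list that starts at cell \<open>i\<close>.\<close>
definition seg :: "(nat \<Rightarrow> nat) \<Rightarrow> nat \<Rightarrow> nat list \<Rightarrow> bool" where
  "seg f i xs \<longleftrightarrow> (\<forall>j<length xs. f (i + j) = xs ! j)"

lemma seg_Nil [simp]: "seg f i []"
  by (simp add: seg_def)

lemma seg_Cons [simp]: "seg f i (x # xs) \<longleftrightarrow> f i = x \<and> seg f (Suc i) xs"
  by (auto simp: seg_def nth_Cons' less_Suc_eq_0_disj)

lemma seg_append [simp]: "seg f i (xs @ ys) \<longleftrightarrow> seg f i xs \<and> seg f (i + length xs) ys"
  by (induction xs arbitrary: i) simp_all

lemma seg_upd [simp]: "a < i \<or> i + length xs \<le> a \<Longrightarrow> seg (f(a := v)) i xs \<longleftrightarrow> seg f i xs"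
proof -
  assume "a < i \<or> i + length xs \<le> a"
  then have "(f(a := v)) (i + j) = f (i + j)" if "j < length xs" for j using that by auto
  then show ?thesis unfolding seg_def by metis
qed

section \<open>The program\<close>
abbreviation com_seq :: "com \<Rightarrow> com \<Rightarrow> com" (infixr ";;" 55) where "p ;; q \<equiv> Seq p q"

text \<open>
  The arrays, apart from the input and the output: \<open>aCnt\<close> counts the neighbours of a vertex that
  are not yet deleted, \<open>aBnd\<close> holds the minimum over the levels passed so far of this count plus
  twice the level, \<open>aLive\<close> and \<open>aDead\<close> list the vertices robust at the current level and the
  deleted ones, \<open>aSort\<close> has the neighbours of each vertex sorted by robustness (in blocks at the
  same offsets as the input), and \<open>aPar\<close> and \<open>aQueue\<close> hold the parents and the queue of the search
  that distributes the labels.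
\<close>

abbreviation (input) "aOff \<equiv> (0 :: nat)"
abbreviation (input) "aAdj \<equiv> (1 :: nat)"
abbreviation (input) "aLab \<equiv> (2 :: nat)"
abbreviation (input) "aCnt \<equiv> (3 :: nat)"
abbreviation (input) "aBnd \<equiv> (4 :: nat)"
abbreviation (input) "aLive \<equiv> (5 :: nat)"
abbreviation (input) "aDead \<equiv> (6 :: nat)"
abbreviation (input) "aSort \<equiv> (7 :: nat)"
abbreviation (input) "aPar \<equiv> (8 :: nat)"
abbreviation (input) "aQueue \<equiv> (9 :: nat)"

abbreviation (input) "rN \<equiv> (0 :: nat)"
abbreviation (input) "rOut \<equiv> (1 :: nat)"
abbreviation (input) "rI \<equiv> (2 :: nat)"
abbreviation (input) "rLive \<equiv> (3 :: nat)"
abbreviation (input) "rK \<equiv> (4 :: nat)"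
abbreviation (input) "rTwoK \<equiv> (5 :: nat)"
abbreviation (input) "rNext \<equiv> (6 :: nat)"
abbreviation (input) "rKept \<equiv> (7 :: nat)"
abbreviation (input) "rDead \<equiv> (8 :: nat)"
abbreviation (input) "rDone \<equiv> (9 :: nat)"
abbreviation (input) "rP \<equiv> (10 :: nat)"
abbreviation (input) "rC \<equiv> (11 :: nat)"
abbreviation (input) "rB \<equiv> (12 :: nat)"
abbreviation (input) "rBest \<equiv> (13 :: nat)"
abbreviation (input) "rRoot \<equiv> (14 :: nat)"
abbreviation (input) "rE \<equiv> (15 :: nat)"
abbreviation (input) "rF \<equiv> (16 :: nat)"
abbreviation (input) "rQ \<equiv> (17 :: nat)"
abbreviation (input) "rO \<equiv> (18 :: nat)"
abbreviation (input) "rHead \<equiv> (19 :: nat)"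
abbreviation (input) "rTail \<equiv> (20 :: nat)"
abbreviation (input) "rU \<equiv> (21 :: nat)"
abbreviation (input) "rR \<equiv> (22 :: nat)"
abbreviation (input) "rL \<equiv> (23 :: nat)"
abbreviation (input) "rOdd \<equiv> (24 :: nat)"
abbreviation (input) "rPar \<equiv> (25 :: nat)"

definition init_loop :: com where
  "init_loop = While (Less (Reg rI) (Reg rN))
    (Load rE aOff (Reg rI) ;; Add rO (Reg rI) (Const 1) ;; Load rF aOff (Reg rO) ;;
     Sub rC (Reg rF) (Reg rE) ;; Store aCnt (Reg rI) (Reg rC) ;; Store aBnd (Reg rI) (Reg rC) ;;
     Store aLive (Reg rI) (Reg rI) ;; Assign rI (Reg rO))"

text \<open>
  One level \<open>k\<close>: update the minimum \<open>aBnd\<close> of each vertex that is still alive. It can carry label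
  \<open>k + 1\<close> if the new minimum is at least \<open>2 * k + 2\<close>, and it is robust at level \<open>k + 1\<close> if the
  minimum is larger than that. The surviving vertices are compacted in place, the others are
  appended to the list of deleted ones. The counters must not change during the scan, so the
  deletions themselves are left to the next loop.
\<close>
definition scan_loop :: com where
  "scan_loop = While (Less (Reg rI) (Reg rLive))
    (Load rP aLive (Reg rI) ;; Add rI (Reg rI) (Const 1) ;;
     Load rC aCnt (Reg rP) ;; Add rC (Reg rC) (Reg rTwoK) ;;
     Load rB aBnd (Reg rP) ;;
     Cond (Less (Reg rC) (Reg rB)) (Assign rB (Reg rC)) Skip ;;
     Store aBnd (Reg rP) (Reg rB) ;;
     Cond (Less (Reg rB) (Reg rNext)) Skip (Add rBest (Reg rK) (Const 1) ;; Assign rRoot (Reg rP)) ;;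
     Cond (Less (Reg rNext) (Reg rB))
       (Store aLive (Reg rKept) (Reg rP) ;; Add rKept (Reg rKept) (Const 1))
       (Store aDead (Reg rDead) (Reg rP) ;; Add rDead (Reg rDead) (Const 1)))"

text \<open>
  The new value of the counter is also the position, within the block of the neighbour, at which
  the deleted vertex is entered. So the blocks fill up from the right.
\<close>
definition delete_loop :: com where
  "delete_loop = While (Less (Reg rE) (Reg rF))
    (Load rQ aAdj (Reg rE) ;; Add rE (Reg rE) (Const 1) ;;
     Load rC aCnt (Reg rQ) ;; Sub rC (Reg rC) (Const 1) ;; Store aCnt (Reg rQ) (Reg rC) ;;
     Load rO aOff (Reg rQ) ;; Add rO (Reg rO) (Reg rC) ;; Store aSort (Reg rO) (Reg rP))"

definition death_loop :: com where
  "death_loop = While (Less (Reg rDone) (Reg rDead))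
    (Load rP aDead (Reg rDone) ;; Add rDone (Reg rDone) (Const 1) ;;
     Load rE aOff (Reg rP) ;; Add rO (Reg rP) (Const 1) ;; Load rF aOff (Reg rO) ;;
     delete_loop)"

definition level_loop :: com where
  "level_loop = While (Less (Const 0) (Reg rLive))
    (Assign rI (Const 0) ;; Assign rKept (Const 0) ;;
     Add rTwoK (Reg rK) (Reg rK) ;; Add rNext (Reg rTwoK) (Const 2) ;;
     scan_loop ;; Assign rLive (Reg rKept) ;; death_loop ;; Add rK (Reg rK) (Const 1))"

text \<open>
  \<open>rR\<close> is the number of children still to be labelled, \<open>rL\<close> is half of it, and \<open>rOdd\<close> its parity;
  this replaces the division that the machine does not have.
\<close>
definition assign_loop :: com where
  "assign_loop = While (Less (Const 0) (Reg rR))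
    (Load rC aSort (Reg rE) ;; Add rE (Reg rE) (Const 1) ;;
     Cond (Equal (Reg rC) (Reg rPar)) Skip
      (Cond (Equal (Reg rOdd) (Const 0))
         (Assign rOdd (Const 1) ;; Sub rL (Reg rL) (Const 1))
         (Assign rOdd (Const 0)) ;;
       Store aLab (Reg rC) (Reg rL) ;; Store aPar (Reg rC) (Reg rU) ;;
       Store aQueue (Reg rTail) (Reg rC) ;; Add rTail (Reg rTail) (Const 1) ;;
       Sub rR (Reg rR) (Const 1)))"

definition queue_loop :: com where
  "queue_loop = While (Less (Reg rHead) (Reg rTail))
    (Load rU aQueue (Reg rHead) ;; Add rHead (Reg rHead) (Const 1) ;;
     Load rL aLab (Reg rU) ;; Add rR (Reg rL) (Reg rL) ;; Assign rOdd (Const 0) ;;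
     Load rE aOff (Reg rU) ;; Load rPar aPar (Reg rU) ;; assign_loop)"

text \<open>The root has the number of vertices as its parent, which differs from all its neighbours.\<close>
definition program :: com where
  "program =
    init_loop ;; Assign rLive (Reg rN) ;; level_loop ;;
    Store aQueue (Const 0) (Reg rRoot) ;; Store aLab (Reg rRoot) (Reg rBest) ;;
    Store aPar (Reg rRoot) (Reg rN) ;; Assign rTail (Const 1) ;; queue_loop ;;
    Add rOut (Reg rBest) (Const 1)"

section \<open>The input graph in memory\<close>

text \<open>
  The graph is seen through its adjacency lists only. Acyclicity appears in the form in which the
  search needs it: no edge can be bypassed. The largest number \<open>W\<close> of a word has to accommodate
  the positions in the concatenated lists and sums of a degree and a doubled level.
\<close>
locale adjacency =
  fixes adj :: "nat list list" and W :: nat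
  assumes nonempty: "adj \<noteq> []"
    and distinct_adj: "i < length adj \<Longrightarrow> distinct (adj ! i)"
    and adj_range: "i < length adj \<Longrightarrow> j \<in> set (adj ! i) \<Longrightarrow> j < length adj"
    and adj_sym: "i < length adj \<Longrightarrow> j \<in> set (adj ! i) \<Longrightarrow> i \<in> set (adj ! j)"
    and separates: "i < length adj \<Longrightarrow> j \<in> set (adj ! i) \<Longrightarrow>
      (i, j) \<notin> {(x, y). x < length adj \<and> y \<in> set (adj ! x) \<and> {x, y} \<noteq> {i, j}}\<^sup>*"
    and word: "3 * length adj + length (concat adj) + 10 \<le> W"
begin

abbreviation n :: nat where "n \<equiv> length adj"
abbreviation N :: "nat \<Rightarrow> nat set" where "N u \<equiv> set (adj ! u)"
abbreviation deg :: "nat \<Rightarrow> nat" where "deg u \<equiv> length (adj ! u)"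
abbreviation rob :: "nat \<Rightarrow> nat \<Rightarrow> bool" where "rob \<equiv> robust N"
abbreviation att :: "nat \<Rightarrow> nat \<Rightarrow> bool" where "att \<equiv> attains N"

definition off :: "nat \<Rightarrow> nat" where "off u = length (concat (take u adj))"

lemma off_Suc: "u < n \<Longrightarrow> off (Suc u) = off u + deg u"
  by (simp add: off_def take_Suc_conv_app_nth)

lemma off_mono: "u \<le> v \<Longrightarrow> off u \<le> off v"
proof (rule lift_Suc_mono_le[where f = off])
  show "off m \<le> off (Suc m)" for m
    by (cases "m < n") (simp_all add: off_Suc, simp add: off_def)
qed

lemma off_n: "off n = length (concat adj)"
  by (simp add: off_def)

lemma off_le: "off u \<le> length (concat adj)"
  using off_mono[of u n] off_n by (cases "u \<le> n") (simp_all add: off_def)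

lemma block_le: "u < n \<Longrightarrow> off u + deg u \<le> length (concat adj)"
  using off_Suc[of u] off_le[of "Suc u"] by simp

lemma block_disjoint: "u < v \<Longrightarrow> v < n \<Longrightarrow> off u + deg u \<le> off v"
  using off_Suc[of u] off_mono[of "Suc u" v] by simp

lemma card_N: "u < n \<Longrightarrow> card (N u) = deg u"
  by (simp add: distinct_adj distinct_card)

lemma deg_le: assumes "u < n" shows "deg u \<le> n"
proof -
  have "card (N u) \<le> card {..<n}" using adj_range[OF assms] by (intro card_mono) auto
  then show ?thesis using card_N[OF assms] by simp
qed

lemma block_input: "u < n \<Longrightarrow> seg (\<lambda>i. arr (input_state adj) 1 i) (off u) (adj ! u)"
proof -
  assume u: "u < n"
  have "adj = take u adj @ adj ! u # drop (Suc u) adj" using u by (rule id_take_nth_drop)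
  then have c: "concat adj = concat (take u adj) @ adj ! u @ concat (drop (Suc u) adj)"
    by (metis concat.simps(2) concat_append)
  show ?thesis
    unfolding seg_def
  proof (intro allI impI)
    fix j assume j: "j < deg u"
    have "off u + j < length (concat adj)" using block_le[OF u] j by simp
    then show "arr (input_state adj) 1 (off u + j) = adj ! u ! j"
      using j by (simp add: input_state_def) (simp add: c off_def nth_append)
  qed
qed

definition static :: "state \<Rightarrow> bool" where
  "static s \<longleftrightarrow> reg s rN = n \<and> (\<forall>u\<le>n. arr s aOff u = off u) \<and>
     (\<forall>u<n. seg (arr s aAdj) (off u) (adj ! u))"

lemma static_input: "static (input_state adj)"
  unfolding static_def using block_input by (auto simp: input_state_def off_def)

lemma static_set_reg [simp]: "x \<noteq> rN \<Longrightarrow> static (set_reg x v s) \<longleftrightarrow> static s"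
  by (auto simp: static_def)

lemma static_set_arr [simp]: "a \<noteq> aOff \<Longrightarrow> a \<noteq> aAdj \<Longrightarrow> static (set_arr a i v s) \<longleftrightarrow> static s"
  by (auto simp: static_def)

lemma static_agree: "agree X Y s s' \<Longrightarrow> rN \<notin> X \<Longrightarrow> aOff \<notin> Y \<Longrightarrow> aAdj \<notin> Y \<Longrightarrow> static s \<Longrightarrow> static s'"
  by (simp add: static_def agree_def)

lemma static_n: "static s \<Longrightarrow> reg s rN = n"
  by (simp add: static_def)

lemma static_off: "static s \<Longrightarrow> u \<le> n \<Longrightarrow> arr s aOff u = off u"
  by (simp add: static_def)

lemma static_adj: "static s \<Longrightarrow> u < n \<Longrightarrow> seg (arr s aAdj) (off u) (adj ! u)"
  by (simp add: static_def)

text \<open>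
  The lemmas on the loops are stated with an arbitrary continuation \<open>Q\<close>: what is known when the
  loop has ended, with \<open>\<rho>\<close> time units left over for the sequel, is the premise under which \<open>Q\<close> is
  required. In this form they apply inside the precondition of a longer program.
\<close>
lemma init_loop:
  assumes "static s" "reg s rI = 0" "10 * n + 1 + \<rho> \<le> \<tau>"
    and Q: "\<And>\<tau>' s'. \<rho> \<le> \<tau>' \<Longrightarrow> agree {rI, rE, rF, rO, rC} {aCnt, aBnd, aLive} s s' \<Longrightarrow>
      (\<forall>u<n. arr s' aCnt u = deg u \<and> arr s' aBnd u = deg u \<and> arr s' aLive u = u) \<Longrightarrow> Q \<tau>' s'"
  shows "wp W init_loop Q \<tau> s"
proof -
  let ?I = "\<lambda>\<tau> s'. agree {rI, rE, rF, rO, rC} {aCnt, aBnd, aLive} s s' \<and> reg s' rI \<le> n \<and>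
    (\<forall>u<reg s' rI. arr s' aCnt u = deg u \<and> arr s' aBnd u = deg u \<and> arr s' aLive u = u) \<and>
    10 * (n - reg s' rI) + 1 + \<rho> \<le> \<tau>"
  show ?thesis
    unfolding init_loop_def
  proof (rule wp_While[where I = ?I])
    show "?I \<tau> s" using assms by simp
    fix \<tau> s'
    assume I: "?I \<tau> s'"
    then have ag: "agree {rI, rE, rF, rO, rC} {aCnt, aBnd, aLive} s s'" by simp
    have st: "static s'" using static_agree[OF ag] assms(1) by simp
    show "1 \<le> \<tau>" using I by simp
    { assume "\<not> holds (Less (Reg rI) (Reg rN)) s'"
      then have "reg s' rI = n" using I static_n[OF st] by simp
      then show "Q (\<tau> - 1) s'" using I by (intro Q) auto }
    { assume "holds (Less (Reg rI) (Reg rN)) s'"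
      then have i: "reg s' rI < n" using static_n[OF st] by simp
      note bounds = word deg_le[OF i] off_le[of "reg s' rI"] off_le[of "Suc (reg s' rI)"]
      have "10 * (n - reg s' rI) = 10 * (n - Suc (reg s' rI)) + 10" using i by simp
      then show "wp W (Load rE aOff (Reg rI) ;; Add rO (Reg rI) (Const 1) ;; Load rF aOff (Reg rO) ;;
       Sub rC (Reg rF) (Reg rE) ;; Store aCnt (Reg rI) (Reg rC) ;; Store aBnd (Reg rI) (Reg rC) ;;
       Store aLive (Reg rI) (Reg rI) ;; Assign rI (Reg rO)) ?I (\<tau> - 1) s'"
        using i I bounds by (auto simp: static_off[OF st] off_Suc less_Suc_eq) }
  qed
qed

text \<open>
  The bookkeeping of the deletions: \<open>\<l> q\<close> are the deleted neighbours of \<open>q\<close>, the latest one first.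
  Together they tie each counter to the part of the block that has been filled.
\<close>
definition recorded :: "(nat \<Rightarrow> nat list) \<Rightarrow> state \<Rightarrow> bool" where
  "recorded \<l> s \<longleftrightarrow> (\<forall>q<n. length (\<l> q) \<le> deg q \<and> arr s aCnt q = deg q - length (\<l> q) \<and>
     seg (arr s aSort) (off q + (deg q - length (\<l> q))) (\<l> q))"

lemma recorded_set_reg [simp]: "recorded \<l> (set_reg x v s) \<longleftrightarrow> recorded \<l> s"
  by (simp add: recorded_def)

lemma recorded_push:
  assumes "recorded \<l> s" "q < n" "length (\<l> q) < deg q"
    and "\<And>r. r < n \<Longrightarrow> r \<noteq> q \<Longrightarrow> \<l>' r = \<l> r" "\<l>' q = p # \<l> q"
    and "arr s' aCnt = (arr s aCnt)(q := arr s aCnt q - 1)"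
    and "arr s' aSort = (arr s aSort)(off q + (arr s aCnt q - 1) := p)"
  shows "recorded \<l>' s'"
  unfolding recorded_def
proof (intro allI impI)
  fix r assume r: "r < n"
  have q: "length (\<l> q) \<le> deg q" "arr s aCnt q = deg q - length (\<l> q)"
      "seg (arr s aSort) (off q + (deg q - length (\<l> q))) (\<l> q)"
    using assms(1,2) by (auto simp: recorded_def)
  show "length (\<l>' r) \<le> deg r \<and> arr s' aCnt r = deg r - length (\<l>' r) \<and>
     seg (arr s' aSort) (off r + (deg r - length (\<l>' r))) (\<l>' r)"
  proof (cases "r = q")
    case True
    have "Suc (off q + (deg q - Suc (length (\<l> q)))) = off q + (deg q - length (\<l> q))"
      using assms(3) by simp
    then show ?thesis using True assms(3,5,6,7) q by simp
  next
    case False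
    have l: "length (\<l> r) \<le> deg r" "arr s aCnt r = deg r - length (\<l> r)"
      "seg (arr s aSort) (off r + (deg r - length (\<l> r))) (\<l> r)"
      using assms(1) r by (auto simp: recorded_def)
    have "off q + deg q \<le> off r \<or> off r + deg r \<le> off q"
      using False r assms(2) block_disjoint by (metis linorder_neqE_nat)
    moreover have "arr s aCnt q - 1 < deg q" using q assms(3) by simp
    ultimately have "off q + (arr s aCnt q - 1) < off r + (deg r - length (\<l> r)) \<or>
        off r + (deg r - length (\<l> r)) + length (\<l> r) \<le> off q + (arr s aCnt q - 1)"
      using l(1) by linarith
    from seg_upd[OF this] l(3)
    have "seg (arr s' aSort) (off r + (deg r - length (\<l> r))) (\<l> r)" by (simp only: assms(7))
    then show ?thesis using False r assms(4)[of r] l by (simp add: assms(6))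
  qed
qed

text \<open>
  Since \<open>adj ! p\<close> has no repetitions, the lists of the neighbours that have been passed are
  extended by \<open>p\<close> and those of all other vertices are as before, which gives the invariant.
\<close>
lemma delete_loop:
  assumes st: "static s" and p: "p < n" "reg s rP = p" "reg s rE = off p" "reg s rF = off p + deg p"
    and base: "recorded base s" "\<And>q. q \<in> N p \<Longrightarrow> length (base q) < deg q"
    and credits: "10 * deg p + 1 + \<rho> \<le> \<tau>"
    and Q: "\<And>\<tau>' s'. \<rho> \<le> \<tau>' \<Longrightarrow> agree {rE, rC, rQ, rO} {aCnt, aSort} s s' \<Longrightarrow>
      recorded (\<lambda>q. if q \<in> N p then p # base q else base q) s' \<Longrightarrow> Q \<tau>' s'"
  shows "wp W delete_loop Q \<tau> s"
proof -
  let ?J = "\<lambda>pre post \<tau> s'. agree {rE, rC, rQ, rO} {aCnt, aSort} s s' \<and>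
    reg s' rE = off p + length pre \<and>
    recorded (\<lambda>q. if q \<in> set pre then p # base q else base q) s' \<and>
    10 * length post + 1 + \<rho> \<le> \<tau>"
  let ?I = "\<lambda>\<tau> s'. \<exists>pre post. adj ! p = pre @ post \<and> ?J pre post \<tau> s'"
  show ?thesis
    unfolding delete_loop_def
  proof (rule wp_While[where I = ?I])
    show "?I \<tau> s" using assms by - (rule exI[of _ "[]"], rule exI[of _ "adj ! p"], simp)
    fix \<tau> s'
    assume "?I \<tau> s'"
    then obtain pre post where split: "adj ! p = pre @ post" and J: "?J pre post \<tau> s'" by blast
    from J have ag: "agree {rE, rC, rQ, rO} {aCnt, aSort} s s'" by simp
    have st': "static s'" using static_agree[OF ag] st by simp
    have regs: "reg s' rP = p" "reg s' rF = off p + deg p" using p agree_reg[OF ag] by simp_all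
    show "1 \<le> \<tau>" using J by simp
    { assume "\<not> holds (Less (Reg rE) (Reg rF)) s'"
      then have "post = []" using J regs split by simp
      then show "Q (\<tau> - 1) s'" using J split by (intro Q) auto }
    { assume "holds (Less (Reg rE) (Reg rF)) s'"
      then obtain q post' where post: "post = q # post'" using J regs split by (cases post) auto
      have split': "adj ! p = (pre @ [q]) @ post'" using split post by simp
      have q: "q \<in> N p" "q \<notin> set pre" using split post distinct_adj[OF p(1)] by auto
      have qn: "q < n" using adj_range[OF p(1) q(1)] .
      have rd: "arr s' aAdj (off p + length pre) = q"
        using static_adj[OF st' p(1)] split post by simp
      have len: "length (base q) < deg q" using base(2) q(1) by simp
      have cnt: "arr s' aCnt q = deg q - length (base q)"
        using J qn q(2) by (auto simp: recorded_def)
      have offq: "arr s' aOff q = off q" using static_off[OF st'] qn by simp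
      note bounds = word deg_le[OF qn] block_le[OF p(1)] block_le[OF qn]
      have pre_len: "length pre < deg p" using split post by simp
      have rec: "recorded (\<lambda>r. if r = q \<or> r \<in> set pre then p # base r else base r) s''"
        if "arr s'' aCnt = (arr s' aCnt)(q := arr s' aCnt q - 1)"
          "arr s'' aSort = (arr s' aSort)(off q + (arr s' aCnt q - 1) := p)" for s''
        using J by (intro recorded_push[where \<l> = "\<lambda>r. if r \<in> set pre then p # base r else base r",
            OF _ qn _ _ _ that]) (use q(2) len in auto)
      have "wp W (Load rQ aAdj (Reg rE) ;; Add rE (Reg rE) (Const 1) ;;
       Load rC aCnt (Reg rQ) ;; Sub rC (Reg rC) (Const 1) ;; Store aCnt (Reg rQ) (Reg rC) ;;
       Load rO aOff (Reg rQ) ;; Add rO (Reg rO) (Reg rC) ;; Store aSort (Reg rO) (Reg rP))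
       (?J (pre @ [q]) post') (\<tau> - 1) s'"
        using J post regs rd cnt offq p(1) qn bounds pre_len by (simp; intro conjI rec; simp)
      then show "wp W (Load rQ aAdj (Reg rE) ;; Add rE (Reg rE) (Const 1) ;;
       Load rC aCnt (Reg rQ) ;; Sub rC (Reg rC) (Const 1) ;; Store aCnt (Reg rQ) (Reg rC) ;;
       Load rO aOff (Reg rQ) ;; Add rO (Reg rO) (Reg rC) ;; Store aSort (Reg rO) (Reg rP))
       ?I (\<tau> - 1) s'"
        by (rule wp_mono) (use split' in blast) }
  qed
qed

end

context adjacency
begin

section \<open>Deleting the vertices in the order of their robustness\<close>

definition nbrs_rob :: "nat \<Rightarrow> nat \<Rightarrow> nat" where
  "nbrs_rob j p = card {q \<in> N p. rob j q}"

text \<open>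
  \<open>a\<close> is the minimum of the degree and the numbers \<open>nbrs_rob j p + 2 * j\<close> for \<open>j < k\<close>. In terms of
  lower bounds this needs no case distinction for \<open>k = 0\<close>, and it yields the two tests below
  directly.
\<close>
definition bound :: "nat \<Rightarrow> nat \<Rightarrow> nat \<Rightarrow> bool" where
  "bound k p a \<longleftrightarrow> (\<forall>x. x \<le> a \<longleftrightarrow> x \<le> deg p \<and> (\<forall>j<k. x \<le> nbrs_rob j p + 2 * j))"

lemma bound_Suc: "bound k p a \<Longrightarrow> bound (Suc k) p (min a (nbrs_rob k p + 2 * k))"
  unfolding bound_def by (simp add: less_Suc_eq) blast

lemma nbrs_rob_0: "p < n \<Longrightarrow> nbrs_rob 0 p = deg p"
  by (simp add: nbrs_rob_def card_N)

lemma nbrs_rob_le: "p < n \<Longrightarrow> nbrs_rob j p \<le> deg p"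
  unfolding nbrs_rob_def by (subst card_N[symmetric]) (auto intro: card_mono)

text \<open>
  Multiplied out, robustness at level \<open>k + 1\<close> says that \<open>2 * k + 3\<close> is a lower bound of
  \<open>nbrs_rob j p + 2 * j\<close> for all \<open>j \<le> k\<close>; the case \<open>j = 0\<close> is the bound on the degree.
\<close>
lemma bound_robust:
  assumes "bound (Suc k) p a" "p < n"
  shows "rob (Suc k) p \<longleftrightarrow> 2 * k + 2 < a"
proof -
  have "2 * k + 2 < a \<longleftrightarrow> 2 * k + 3 \<le> deg p \<and> (\<forall>j<Suc k. 2 * k + 3 \<le> nbrs_rob j p + 2 * j)"
    using assms(1)[unfolded bound_def, rule_format, of "2 * k + 3"] by (simp add: Suc_le_eq numeral_3_eq_3)
  also have "\<dots> \<longleftrightarrow> (\<forall>j<Suc k. 2 * (Suc k - j) + 1 \<le> nbrs_rob j p)"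
  proof (intro iffI conjI allI impI; (elim conjE)?)
    fix j assume "\<forall>j<Suc k. 2 * k + 3 \<le> nbrs_rob j p + 2 * j" "j < Suc k"
    then have "2 * k + 3 \<le> nbrs_rob j p + 2 * j" by blast
    then show "2 * (Suc k - j) + 1 \<le> nbrs_rob j p" using \<open>j < Suc k\<close> by linarith
  next
    assume "\<forall>j<Suc k. 2 * (Suc k - j) + 1 \<le> nbrs_rob j p"
    then have "2 * (Suc k - 0) + 1 \<le> nbrs_rob 0 p" by blast
    then show "2 * k + 3 \<le> deg p" using nbrs_rob_0[OF assms(2)] by simp
  next
    fix j assume "\<forall>j<Suc k. 2 * (Suc k - j) + 1 \<le> nbrs_rob j p" "j < Suc k"
    then have "2 * (Suc k - j) + 1 \<le> nbrs_rob j p" by blast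
    then show "2 * k + 3 \<le> nbrs_rob j p + 2 * j" using \<open>j < Suc k\<close> by linarith
  qed
  also have "\<dots> \<longleftrightarrow> rob (Suc k) p"
    unfolding nbrs_rob_def using robustI[of "Suc k" N p] robustD[of N "Suc k" p] by blast
  finally show ?thesis by blast
qed

lemma bound_attains:
  assumes "bound (Suc k) p a" "p < n"
  shows "att (Suc k) p \<longleftrightarrow> 2 * k + 2 \<le> a"
proof -
  have "2 * k + 2 \<le> a \<longleftrightarrow> 2 * k + 2 \<le> deg p \<and> (\<forall>j<Suc k. 2 * k + 2 \<le> nbrs_rob j p + 2 * j)"
    using assms(1)[unfolded bound_def, rule_format, of "2 * k + 2"] .
  also have "\<dots> \<longleftrightarrow> (\<forall>j<Suc k. 2 * (Suc k - j) \<le> nbrs_rob j p)"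
  proof (intro iffI conjI allI impI; (elim conjE)?)
    fix j assume "\<forall>j<Suc k. 2 * k + 2 \<le> nbrs_rob j p + 2 * j" "j < Suc k"
    then have "2 * k + 2 \<le> nbrs_rob j p + 2 * j" by blast
    then show "2 * (Suc k - j) \<le> nbrs_rob j p" using \<open>j < Suc k\<close> by linarith
  next
    assume "\<forall>j<Suc k. 2 * (Suc k - j) \<le> nbrs_rob j p"
    then have "2 * (Suc k - 0) \<le> nbrs_rob 0 p" by blast
    then show "2 * k + 2 \<le> deg p" using nbrs_rob_0[OF assms(2)] by simp
  next
    fix j assume "\<forall>j<Suc k. 2 * (Suc k - j) \<le> nbrs_rob j p" "j < Suc k"
    then have "2 * (Suc k - j) \<le> nbrs_rob j p" by blast
    then show "2 * k + 2 \<le> nbrs_rob j p + 2 * j" using \<open>j < Suc k\<close> by linarith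
  qed
  also have "\<dots> \<longleftrightarrow> att (Suc k) p"
    unfolding nbrs_rob_def attains_def by blast
  finally show ?thesis by blast
qed

text \<open>
  The list of the surviving vertices overwrites the list that is being read. This is safe
  because a vertex is moved only to a cell that has been read before.
\<close>
lemma scan_loop:
  assumes st: "static s" and live: "seg (arr s aLive) 0 xs" "distinct xs" "set xs \<subseteq> {..<n}"
    and dead: "seg (arr s aDead) 0 ds" "length ds + length xs \<le> n"
    and cnt: "\<And>q. q < n \<Longrightarrow> arr s aCnt q = nbrs_rob k q"
    and bnd: "\<And>p. p \<in> set xs \<Longrightarrow> bound k p (arr s aBnd p)"
    and regs: "reg s rLive = length xs" "reg s rK = k" "reg s rTwoK = 2 * k"
      "reg s rNext = 2 * k + 2" "reg s rI = 0" "reg s rKept = 0" "reg s rDead = length ds"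
    and k: "2 * k \<le> n" and credits: "20 * length xs + 1 + \<rho> \<le> \<tau>"
    and Q: "\<And>\<tau>' s'. \<rho> \<le> \<tau>' \<Longrightarrow>
      agree {rI, rKept, rDead, rP, rC, rB, rBest, rRoot} {aLive, aDead, aBnd} s s' \<Longrightarrow>
      reg s' rKept = length (filter (rob (Suc k)) xs) \<Longrightarrow>
      seg (arr s' aLive) 0 (filter (rob (Suc k)) xs) \<Longrightarrow>
      reg s' rDead = length ds + length (filter (\<lambda>p. \<not> rob (Suc k) p) xs) \<Longrightarrow>
      seg (arr s' aDead) 0 (ds @ filter (\<lambda>p. \<not> rob (Suc k) p) xs) \<Longrightarrow>
      (\<And>p. p \<in> set xs \<Longrightarrow> bound (Suc k) p (arr s' aBnd p)) \<Longrightarrow>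
      (if \<exists>p\<in>set xs. att (Suc k) p
        then reg s' rBest = Suc k \<and> reg s' rRoot \<in> set xs \<and> att (Suc k) (reg s' rRoot)
        else reg s' rBest = reg s rBest \<and> reg s' rRoot = reg s rRoot) \<Longrightarrow> Q \<tau>' s'"
  shows "wp W scan_loop Q \<tau> s"
proof -
  let ?J = "\<lambda>pre post \<tau> s'.
    agree {rI, rKept, rDead, rP, rC, rB, rBest, rRoot} {aLive, aDead, aBnd} s s' \<and>
    reg s' rI = length pre \<and>
    reg s' rKept = length (filter (rob (Suc k)) pre) \<and>
    seg (arr s' aLive) 0 (filter (rob (Suc k)) pre) \<and> seg (arr s' aLive) (length pre) post \<and>
    reg s' rDead = length ds + length (filter (\<lambda>p. \<not> rob (Suc k) p) pre) \<and>
    seg (arr s' aDead) 0 (ds @ filter (\<lambda>p. \<not> rob (Suc k) p) pre) \<and>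
    (\<forall>p\<in>set pre. bound (Suc k) p (arr s' aBnd p)) \<and> (\<forall>p\<in>set post. bound k p (arr s' aBnd p)) \<and>
    (if \<exists>p\<in>set pre. att (Suc k) p
      then reg s' rBest = Suc k \<and> reg s' rRoot \<in> set pre \<and> att (Suc k) (reg s' rRoot)
      else reg s' rBest = reg s rBest \<and> reg s' rRoot = reg s rRoot) \<and>
    20 * length post + 1 + \<rho> \<le> \<tau>"
  let ?I = "\<lambda>\<tau> s'. \<exists>pre post. xs = pre @ post \<and> ?J pre post \<tau> s'"
  show ?thesis
    unfolding scan_loop_def
  proof (rule wp_While[where I = ?I])
    show "?I \<tau> s" using assms by - (rule exI[of _ "[]"], rule exI[of _ xs], simp)
    fix \<tau> s'
    assume "?I \<tau> s'"
    then obtain pre post where split: "xs = pre @ post" and J: "?J pre post \<tau> s'" by blast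
    from J have ag: "agree {rI, rKept, rDead, rP, rC, rB, rBest, rRoot} {aLive, aDead, aBnd} s s'" by simp
    have regs': "reg s' rLive = length xs" "reg s' rK = k" "reg s' rTwoK = 2 * k"
      "reg s' rNext = 2 * k + 2" using regs agree_reg[OF ag] by simp_all
    show "1 \<le> \<tau>" using J by simp
    { assume "\<not> holds (Less (Reg rI) (Reg rLive)) s'"
      then have "post = []" using J regs' split by simp
      then have "pre = xs" using split by simp
      show "Q (\<tau> - 1) s'"
        using J unfolding \<open>pre = xs\<close> by (intro Q; elim conjE) (simp_all del: seg_append) }
    { assume "holds (Less (Reg rI) (Reg rLive)) s'"
      then obtain p post' where post: "post = p # post'" using J regs' split by (cases post) auto
      have split': "xs = (pre @ [p]) @ post'" using split post by simp
      have p: "p < n" "p \<notin> set pre" "p \<notin> set post'" using live(2,3) split post by auto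
      have rd: "arr s' aLive (length pre) = p" using J post by simp
      have c: "arr s' aCnt p = nbrs_rob k p" using cnt[OF p(1)] agree_arr[OF ag] by simp
      define a where "a = min (arr s' aBnd p) (nbrs_rob k p + 2 * k)"
      have ba: "bound (Suc k) p a" unfolding a_def using J post by (intro bound_Suc) simp
      have old_le: "arr s' aBnd p \<le> deg p" using J post by (auto simp: bound_def)
      have r: "rob (Suc k) p \<longleftrightarrow> 2 * k + 2 < a" by (rule bound_robust[OF ba p(1)])
      have at: "att (Suc k) p \<longleftrightarrow> 2 * k + 2 \<le> a" by (rule bound_attains[OF ba p(1)])
      have live_upd: "seg ((arr s' aLive)(length (filter (rob (Suc k)) pre) := v)) (Suc (length pre)) post'"
        for v
        using J post by (subst seg_upd) (auto simp: less_Suc_eq_le)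
      note bounds = word deg_le[OF p(1)] nbrs_rob_le[OF p(1), of k] old_le k dead(2)
      have len: "length xs = Suc (length pre + length post')" using split post by simp
      have filter_le: "length (filter P pre) \<le> length pre" for P :: "nat \<Rightarrow> bool" by simp
      have fits: "Suc (length (filter (rob (Suc k)) pre)) \<le> W"
          "Suc (length ds + length (filter (\<lambda>p. \<not> rob (Suc k) p) pre)) \<le> W"
        using filter_le[of "rob (Suc k)"] filter_le[of "\<lambda>p. \<not> rob (Suc k) p"] bounds len by linarith+
      let ?body = "(Load rP aLive (Reg rI) ;; Add rI (Reg rI) (Const 1) ;;
         Load rC aCnt (Reg rP) ;; Add rC (Reg rC) (Reg rTwoK) ;;
         Load rB aBnd (Reg rP) ;;
         Cond (Less (Reg rC) (Reg rB)) (Assign rB (Reg rC)) Skip ;;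
         Store aBnd (Reg rP) (Reg rB) ;;
         Cond (Less (Reg rB) (Reg rNext)) Skip (Add rBest (Reg rK) (Const 1) ;; Assign rRoot (Reg rP)) ;;
         Cond (Less (Reg rNext) (Reg rB))
           (Store aLive (Reg rKept) (Reg rP) ;; Add rKept (Reg rKept) (Const 1))
           (Store aDead (Reg rDead) (Reg rP) ;; Add rDead (Reg rDead) (Const 1)))"
      \<comment> \<open>Opaque names for the rest of the body and for the invariant after it, so that the
        simplifier stops after the first few instructions.\<close>
      define update where "update = (Store aBnd (Reg rP) (Reg rB) ;;
         Cond (Less (Reg rB) (Reg rNext)) Skip (Add rBest (Reg rK) (Const 1) ;; Assign rRoot (Reg rP)) ;;
         Cond (Less (Reg rNext) (Reg rB))
           (Store aLive (Reg rKept) (Reg rP) ;; Add rKept (Reg rKept) (Const 1))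
           (Store aDead (Reg rDead) (Reg rP) ;; Add rDead (Reg rDead) (Const 1)))"
      have tail: "wp W update (?J (pre @ [p]) post') \<tau>' s''"
        if "agree {rI, rP, rC, rB} {} s' s''" "reg s'' rI = Suc (length pre)" "reg s'' rP = p"
          "reg s'' rB = a" "20 * length post' + 10 + \<rho> \<le> \<tau>'" for \<tau>' s''
      proof -
        have ag2: "agree {rI, rKept, rDead, rP, rC, rB, rBest, rRoot} {aLive, aDead, aBnd} s s''"
          by (rule agree_trans[OF ag that(1)]) auto
        have same: "reg s'' rNext = 2 * k + 2" "reg s'' rK = k" "reg s'' rKept = reg s' rKept"
          "reg s'' rDead = reg s' rDead" "reg s'' rBest = reg s' rBest" "reg s'' rRoot = reg s' rRoot"
          "arr s'' = arr s'"
          using agree_reg[OF that(1)] agree_arr[OF that(1)] regs' by auto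
        have aW: "a \<le> W" using bounds by (simp add: a_def)
        consider "a < 2 * k + 2" | "a = 2 * k + 2" | "2 * k + 2 < a" by linarith
        then show ?thesis
        proof cases
          case 1
          then show ?thesis
            unfolding update_def using J post that(2-5) same ag2 aW ba r at p fits live_upd bounds len by auto
        next
          case 2
          then show ?thesis
            unfolding update_def using J post that(2-5) same ag2 aW ba r at p fits live_upd bounds len by auto
        next
          case 3
          then show ?thesis
            unfolding update_def using J post that(2-5) same ag2 aW ba r at p fits live_upd bounds len by auto
        qed
      qed
      define G where "G = ?J (pre @ [p]) post'"
      note tail' = tail[folded G_def]
      have "reg s' rI = length pre" "21 + 20 * length post' + \<rho> \<le> \<tau>" using J post by auto
      then have "wp W ?body G (\<tau> - 1) s'"
        unfolding update_def[symmetric]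
        using post rd c bounds p(1) len regs'
        by (simp, intro conjI impI tail') (simp_all add: a_def)
      then show "wp W ?body ?I (\<tau> - 1) s'"
        unfolding G_def by (rule wp_mono) (use split' in blast) }
  qed
qed

end

context adjacency
begin

lemma recorded_cong:
  "recorded \<l> s \<Longrightarrow> (\<And>q. q < n \<Longrightarrow> \<l>' q = \<l> q) \<Longrightarrow> recorded \<l>' s"
  unfolding recorded_def by metis

lemma recorded_arr:
  "recorded \<l> s \<Longrightarrow> arr s' aCnt = arr s aCnt \<Longrightarrow> arr s' aSort = arr s aSort \<Longrightarrow> recorded \<l> s'"
  unfolding recorded_def by metis

text \<open>The content of the block of \<open>q\<close> once the vertices \<open>ds\<close> have been deleted in this order.\<close>
definition nbrs_in :: "nat list \<Rightarrow> nat \<Rightarrow> nat list" where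
  "nbrs_in ds q = rev (filter (\<lambda>p. p \<in> N q) ds)"

lemma length_nbrs_in: "distinct ds \<Longrightarrow> length (nbrs_in ds q) = card (set (nbrs_in ds q))"
proof -
  assume "distinct ds"
  then have "distinct (nbrs_in ds q)" by (simp add: nbrs_in_def)
  then show ?thesis by (metis distinct_card)
qed

text \<open>There is room in the block of \<open>q\<close> as long as some neighbour is missing from it.\<close>
lemma length_nbrs_in_less:
  assumes "distinct ds" "p \<notin> set ds" "p \<in> N q" "q < n"
  shows "length (nbrs_in ds q) < deg q"
proof -
  have "length (nbrs_in ds q) = card (set (nbrs_in ds q))"
    using assms(1) by (rule length_nbrs_in)
  also have "\<dots> < card (N q)"
    by (rule psubset_card_mono) (use assms in \<open>auto simp: nbrs_in_def\<close>)
  finally show ?thesis using card_N[OF assms(4)] by simp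
qed

lemma death_loop:
  assumes st: "static s" and dead: "seg (arr s aDead) 0 (old @ new)" "distinct (old @ new)"
      "set (old @ new) \<subseteq> {..<n}"
    and regs: "reg s rDone = length old" "reg s rDead = length (old @ new)"
    and rec: "recorded (nbrs_in old) s"
    and credits: "sum_list (map (\<lambda>p. 10 * deg p + 10) new) + 1 + \<rho> \<le> \<tau>"
    and Q: "\<And>\<tau>' s'. \<rho> \<le> \<tau>' \<Longrightarrow> agree {rP, rDone, rE, rO, rF, rC, rQ} {aCnt, aSort} s s' \<Longrightarrow>
      reg s' rDone = length (old @ new) \<Longrightarrow> recorded (nbrs_in (old @ new)) s' \<Longrightarrow> Q \<tau>' s'"
  shows "wp W death_loop Q \<tau> s"
proof -
  let ?J = "\<lambda>pre post \<tau> s'. agree {rP, rDone, rE, rO, rF, rC, rQ} {aCnt, aSort} s s' \<and>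
    reg s' rDone = length (old @ pre) \<and> recorded (nbrs_in (old @ pre)) s' \<and>
    sum_list (map (\<lambda>p. 10 * deg p + 10) post) + 1 + \<rho> \<le> \<tau>"
  let ?I = "\<lambda>\<tau> s'. \<exists>pre post. new = pre @ post \<and> ?J pre post \<tau> s'"
  show ?thesis
    unfolding death_loop_def
  proof (rule wp_While[where I = ?I])
    show "?I \<tau> s" using assms by - (rule exI[of _ "[]"], rule exI[of _ new], simp)
    fix \<tau> s'
    assume "?I \<tau> s'"
    then obtain pre post where split: "new = pre @ post" and J: "?J pre post \<tau> s'" by blast
    from J have ag: "agree {rP, rDone, rE, rO, rF, rC, rQ} {aCnt, aSort} s s'" by simp
    have st': "static s'" using static_agree[OF ag] st by simp
    have regs': "reg s' rDead = length (old @ new)" using regs agree_reg[OF ag] by simp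
    show "1 \<le> \<tau>" using J by simp
    { assume "\<not> holds (Less (Reg rDone) (Reg rDead)) s'"
      then have "post = []" using J regs' split by simp
      then have "pre = new" using split by simp
      show "Q (\<tau> - 1) s'" using J unfolding \<open>pre = new\<close> by (intro Q; elim conjE) simp_all }
    { assume "holds (Less (Reg rDone) (Reg rDead)) s'"
      then obtain p post' where post: "post = p # post'" using J regs' split by (cases post) auto
      have split': "new = (pre @ [p]) @ post'" using split post by simp
      have p: "p < n" "p \<notin> set (old @ pre)" "distinct (old @ pre)"
        using dead(2,3) split post by auto
      have rd: "arr s' aDead (length old + length pre) = p"
        using dead(1) split post agree_arr[OF ag] by simp
      have "length (old @ new) = card (set (old @ new))" using dead(2) by (metis distinct_card)
      also have "\<dots> \<le> card {..<n}" using dead(3) by (intro card_mono) auto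
      finally have len: "Suc (length old + length pre) \<le> n" using split post by simp
      note bounds = word off_le[of p] block_le[OF p(1)]
      define G where "G = ?J (pre @ [p]) post'"
      have del: "wp W delete_loop G \<tau>' s''"
        if "agree {rP, rDone, rE, rO, rF} {} s' s''" "reg s'' rP = p" "reg s'' rE = off p"
          "reg s'' rF = off p + deg p" "reg s'' rDone = Suc (length old + length pre)"
          "10 * deg p + 1 + (sum_list (map (\<lambda>p. 10 * deg p + 10) post') + 1 + \<rho>) \<le> \<tau>'" for \<tau>' s''
      proof (rule delete_loop)
        show "static s''" using static_agree[OF that(1)] st' by simp
        show "recorded (nbrs_in (old @ pre)) s''"
          by (rule recorded_arr[of _ s']) (use J agree_arr[OF that(1)] in auto)
        show "length (nbrs_in (old @ pre) q) < deg q" if "q \<in> N p" for q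
          using length_nbrs_in_less[OF p(3,2)] adj_sym[OF p(1) that] adj_range[OF p(1) that] by blast
        fix \<tau>'' u
        assume fin: "sum_list (map (\<lambda>p. 10 * deg p + 10) post') + 1 + \<rho> \<le> \<tau>''"
          "agree {rE, rC, rQ, rO} {aCnt, aSort} s'' u"
          "recorded (\<lambda>q. if q \<in> N p then p # nbrs_in (old @ pre) q else nbrs_in (old @ pre) q) u"
        have "agree {rP, rDone, rE, rO, rF, rC, rQ} {aCnt, aSort} s s''"
          by (rule agree_trans[OF ag that(1)]) auto
        then have "agree {rP, rDone, rE, rO, rF, rC, rQ} {aCnt, aSort} s u"
          by (rule agree_trans[OF _ fin(2)]) auto
        moreover have "reg u rDone = length (old @ pre @ [p])"
          using agree_reg[OF fin(2)] that(5) by simp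
        moreover have "recorded (nbrs_in (old @ pre @ [p])) u"
        proof (rule recorded_cong[OF fin(3)])
          fix q assume "q < n"
          then have "p \<in> N q \<longleftrightarrow> q \<in> N p" using adj_sym p(1) by blast
          then show "nbrs_in (old @ pre @ [p]) q =
              (if q \<in> N p then p # nbrs_in (old @ pre) q else nbrs_in (old @ pre) q)"
            by (simp add: nbrs_in_def)
        qed
        ultimately show "G \<tau>'' u" unfolding G_def using fin(1) by simp
      qed (use that p in simp_all)
      have "reg s' rDone = length old + length pre"
        "10 * deg p + 10 + sum_list (map (\<lambda>p. 10 * deg p + 10) post') + 1 + \<rho> \<le> \<tau>"
        using J post by auto
      then have "wp W (Load rP aDead (Reg rDone) ;; Add rDone (Reg rDone) (Const 1) ;;
         Load rE aOff (Reg rP) ;; Add rO (Reg rP) (Const 1) ;; Load rF aOff (Reg rO) ;;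
         delete_loop) G (\<tau> - 1) s'"
        using rd bounds p(1) len static_off[OF st', of p] static_off[OF st', of "Suc p"] off_Suc[OF p(1)]
        by (simp, intro conjI impI del) simp_all
      then show "wp W (Load rP aDead (Reg rDone) ;; Add rDone (Reg rDone) (Const 1) ;;
         Load rE aOff (Reg rP) ;; Add rO (Reg rP) (Const 1) ;; Load rF aOff (Reg rO) ;;
         delete_loop) ?I (\<tau> - 1) s'"
        unfolding G_def by (rule wp_mono) (use split' in blast) }
  qed
qed

text \<open>
  What the counters hold when all vertices that are not robust at level \<open>k\<close> have been deleted is
  what the scan of level \<open>k\<close> has to read.
\<close>
lemma nbrs_rob_complement:
  assumes "distinct ds" "set ds = {p. p < n \<and> \<not> rob k p}" "q < n"
  shows "deg q - length (nbrs_in ds q) = nbrs_rob k q"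
proof -
  have "length (nbrs_in ds q) = card (set (nbrs_in ds q))"
    using assms(1) by (rule length_nbrs_in)
  also have "set (nbrs_in ds q) = {p \<in> N q. \<not> rob k p}"
    using assms(2) adj_range[OF assms(3)] by (auto simp: nbrs_in_def)
  finally have "length (nbrs_in ds q) = card {p \<in> N q. \<not> rob k p}" .
  moreover have "card (N q) = card {p \<in> N q. rob k p} + card {p \<in> N q. \<not> rob k p}"
    by (subst card_Un_disjoint[symmetric]) (auto intro!: arg_cong[of _ _ card])
  ultimately show ?thesis using card_N[OF assms(3)] by (simp add: nbrs_rob_def)
qed

definition live :: "nat \<Rightarrow> nat set" where "live k = {p. p < n \<and> rob k p}"

definition less_robust :: "nat \<Rightarrow> nat \<Rightarrow> bool" where
  "less_robust p q \<longleftrightarrow> (\<forall>j. rob j p \<longrightarrow> rob j q)"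

lemma finite_live [simp]: "finite (live k)"
  by (simp add: live_def)

lemma live_Suc: "live (Suc k) \<subseteq> live k"
  unfolding live_def using robust_antimono[of N "Suc k" _ k] by auto

lemma live_degree: "p \<in> live k \<Longrightarrow> 2 * k \<le> deg p"
  unfolding live_def using robust_degree[of N k p] card_N by auto

text \<open>
  Each vertex pays 40 units for each level at which it is robust, from a deposit of 40 units for
  each neighbour and 40 more, and it pays for its own deletion at the end. The deposit suffices because
  robustness at level \<open>k\<close> requires degree at least \<open>2 * k\<close>. The best label is found on the way: a
  vertex that attains \<open>k + 1\<close> is robust at level \<open>k\<close>, hence is seen by the scan of level \<open>k\<close>.
\<close>
lemma level_loop:
  assumes st: "static s" and regs: "reg s rK = 0" "reg s rLive = n" "reg s rDone = 0" "reg s rDead = 0"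
      "reg s rBest = 0" "reg s rRoot = 0"
    and init: "\<And>u. u < n \<Longrightarrow> arr s aCnt u = deg u \<and> arr s aBnd u = deg u \<and> arr s aLive u = u"
    and credits: "40 * (\<Sum>p<n. deg p + 1) + (\<Sum>p<n. 10 * deg p + 10) + 1 + \<rho> \<le> \<tau>"
    and Q: "\<And>\<tau>' s' ds. \<rho> \<le> \<tau>' \<Longrightarrow>
      agree {rI, rLive, rK, rTwoK, rNext, rKept, rDead, rDone, rP, rC, rB, rBest, rRoot, rE, rF, rQ, rO}
        {aCnt, aBnd, aLive, aDead, aSort} s s' \<Longrightarrow>
      distinct ds \<Longrightarrow> set ds = {..<n} \<Longrightarrow> sorted_wrt less_robust ds \<Longrightarrow> recorded (nbrs_in ds) s' \<Longrightarrow>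
      reg s' rRoot < n \<Longrightarrow> att (reg s' rBest) (reg s' rRoot) \<Longrightarrow>
      (\<And>j p. p < n \<Longrightarrow> att j p \<Longrightarrow> j \<le> reg s' rBest) \<Longrightarrow> Q \<tau>' s'"
  shows "wp W level_loop Q \<tau> s"
proof -
  let ?X = "{rI, rLive, rK, rTwoK, rNext, rKept, rDead, rDone, rP, rC, rB, rBest, rRoot, rE, rF, rQ, rO}"
  let ?Y = "{aCnt, aBnd, aLive, aDead, aSort}"
  define \<Phi> where "\<Phi> k = 40 * (\<Sum>p\<in>live k. deg p + 1 - k) + (\<Sum>p\<in>live k. 10 * deg p + 10)" for k
  let ?J = "\<lambda>k xs ds \<tau> s'. agree ?X ?Y s s' \<and> reg s' rK = k \<and> reg s' rLive = length xs \<and>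
    seg (arr s' aLive) 0 xs \<and> distinct xs \<and> set xs = live k \<and>
    reg s' rDead = length ds \<and> reg s' rDone = length ds \<and> seg (arr s' aDead) 0 ds \<and> distinct ds \<and>
    set ds = {p. p < n \<and> \<not> rob k p} \<and> sorted_wrt less_robust ds \<and> recorded (nbrs_in ds) s' \<and>
    (\<forall>p\<in>live k. bound k p (arr s' aBnd p)) \<and>
    reg s' rRoot < n \<and> att (reg s' rBest) (reg s' rRoot) \<and>
    (\<forall>j p. j \<le> k \<longrightarrow> p < n \<longrightarrow> att j p \<longrightarrow> j \<le> reg s' rBest) \<and> \<Phi> k + 1 + \<rho> \<le> \<tau>"
  let ?I = "\<lambda>\<tau> s'. \<exists>k xs ds. ?J k xs ds \<tau> s'"
  let ?body = "Assign rI (Const 0) ;; Assign rKept (Const 0) ;;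
     Add rTwoK (Reg rK) (Reg rK) ;; Add rNext (Reg rTwoK) (Const 2) ;;
     scan_loop ;; Assign rLive (Reg rKept) ;; death_loop ;; Add rK (Reg rK) (Const 1)"
  have I: "?I \<tau> u" if "?J k xs ds \<tau> u" for k xs ds \<tau> u
    using that by - (rule exI[of _ k], rule exI[of _ xs], rule exI[of _ ds])
  show ?thesis
    unfolding level_loop_def
  proof (rule wp_While[where I = ?I])
    have live0: "live 0 = {..<n}" by (auto simp: live_def)
    have "?J 0 [0..<n] [] \<tau> s"
    proof (intro conjI)
      show "seg (arr s aLive) 0 [0..<n]" using init by (simp add: seg_def)
      show "recorded (nbrs_in []) s" using init by (simp add: recorded_def nbrs_in_def)
      show "\<forall>p\<in>live 0. bound 0 p (arr s aBnd p)" using init by (simp add: live0 bound_def)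
      show "att (reg s rBest) (reg s rRoot)" using regs by (simp add: attains_def)
      show "\<Phi> 0 + 1 + \<rho> \<le> \<tau>" using credits by (simp add: \<Phi>_def live0)
      show "set [0..<n] = live 0" unfolding live0 by auto
      show "set [] = {p. p < n \<and> \<not> rob 0 p}" by simp
      show "reg s rRoot < n" using regs nonempty by simp
    qed (use regs in simp_all)
    then show "?I \<tau> s" by (rule I)
    fix \<tau> s'
    assume "?I \<tau> s'"
    then obtain k xs ds where J: "?J k xs ds \<tau> s'" by (elim exE)
    from J have ag: "agree ?X ?Y s s'" by simp
    have st': "static s'" using static_agree[OF ag] st by simp
    show "1 \<le> \<tau>" using J by simp
    { assume "\<not> holds (Less (Const 0) (Reg rLive)) s'"
      then have "xs = []" using J by simp
      then have none: "live k = {}" using J by simp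
      have top: "j \<le> reg s' rBest" if "p < n" "att j p" for j p
      proof (cases "j \<le> k")
        case True
        then show ?thesis using J that by blast
      next
        case False
        then obtain i where i: "j = Suc i" "k \<le> i" by (cases j) auto
        then have "rob i p" using attains_Suc_robust[of N i p] that(2) by simp
        then have "rob k p" using i(2) by (rule robust_antimono)
        then show ?thesis using none that(1) by (auto simp: live_def)
      qed
      show "Q (\<tau> - 1) s'"
        by (rule Q[of _ _ ds]) (use J none top in \<open>auto simp: live_def\<close>) }
    { assume "holds (Less (Const 0) (Reg rLive)) s'"
      then have "xs \<noteq> []" using J by auto
      then obtain p where p: "p \<in> live k" using J by (metis list.set_intros(1) neq_Nil_conv)
      then have "p < n" by (simp add: live_def)
      have k2: "2 * k \<le> n" using live_degree[OF p] deg_le[OF \<open>p < n\<close>] by simp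
      define kept where "kept = filter (rob (Suc k)) xs"
      define new where "new = filter (\<lambda>p. \<not> rob (Suc k) p) xs"
      have kept: "distinct kept" "set kept = live (Suc k)"
        using J live_Suc[of k] unfolding kept_def by (auto simp: live_def)
      have new: "distinct new" "set new = live k - live (Suc k)"
        using J unfolding new_def by (auto simp: live_def)
      have dsn: "distinct (ds @ new)" "set (ds @ new) = {p. p < n \<and> \<not> rob (Suc k) p}"
        using J new live_Suc[of k] by (auto simp: live_def)
      have dxs: "distinct ds" "distinct xs" "set ds \<inter> set xs = {}" using J by (auto simp: live_def)
      have "length ds + length xs = card (set ds \<union> set xs)"
        using dxs by (simp add: card_Un_disjoint distinct_card)
      also have "\<dots> \<le> card {..<n}" using J by (intro card_mono) (auto simp: live_def)
      finally have lens: "length ds + length xs \<le> n" by simp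
      have srt: "sorted_wrt less_robust (ds @ new)"
      proof -
        have lr: "less_robust a b" if "a \<in> set (ds @ new)" "b \<in> set new" for a b
          unfolding less_robust_def
        proof (intro allI impI)
          fix j assume "rob j a"
          moreover have "\<not> rob (Suc k) a" using that(1) dsn(2) by blast
          ultimately have "j \<le> k" using robust_antimono[of N j a "Suc k"] by (metis not_less_eq_eq)
          moreover have "rob k b" using that(2) new(2) by (simp add: live_def)
          ultimately show "rob j b" using robust_antimono[of N k b j] by blast
        qed
        then have "sorted_wrt less_robust new"
          unfolding sorted_wrt_iff_nth_less by simp
        then show ?thesis using J lr by (simp add: sorted_wrt_append)
      qed
      have pot: "\<Phi> (Suc k) + 40 * length xs + sum_list (map (\<lambda>p. 10 * deg p + 10) new) \<le> \<Phi> k"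
      proof -
        have "length xs = card (live k)" using J by (metis distinct_card)
        have "(\<Sum>p\<in>live (Suc k). deg p + 1 - Suc k) + card (live k)
            \<le> (\<Sum>p\<in>live k. deg p + 1 - Suc k) + card (live k)"
          using live_Suc[of k] by (intro add_mono sum_mono2) auto
        also have "\<dots> = (\<Sum>p\<in>live k. (deg p + 1 - Suc k) + 1)" by (simp only: sum.distrib) simp
        also have "\<dots> = (\<Sum>p\<in>live k. deg p + 1 - k)"
        proof (rule sum.cong)
          fix p assume "p \<in> live k"
          then show "deg p + 1 - Suc k + 1 = deg p + 1 - k" using live_degree[of p k] by linarith
        qed simp
        finally have a: "(\<Sum>p\<in>live (Suc k). deg p + 1 - Suc k) + length xs
            \<le> (\<Sum>p\<in>live k. deg p + 1 - k)" using \<open>length xs = card (live k)\<close> by simp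
        have "sum_list (map (\<lambda>p. 10 * deg p + 10) new) = (\<Sum>p\<in>live k - live (Suc k). 10 * deg p + 10)"
          using new by (metis sum.distinct_set_conv_list)
        moreover have "(\<Sum>p\<in>live k. 10 * deg p + 10) =
            (\<Sum>p\<in>live k - live (Suc k). 10 * deg p + 10) + (\<Sum>p\<in>live (Suc k). 10 * deg p + 10)"
          using live_Suc[of k] by (intro sum.subset_diff) auto
        ultimately show ?thesis unfolding \<Phi>_def using a by linarith
      qed
      have len1: "1 \<le> length xs" using \<open>xs \<noteq> []\<close> by (cases xs) auto
      define G where "G = ?J (Suc k) kept (ds @ new)"
      define death where "death = Assign rLive (Reg rKept) ;; death_loop ;; Add rK (Reg rK) (Const 1)"
      define \<rho>' where "\<rho>' = sum_list (map (\<lambda>p. 10 * deg p + 10) new) + 4 + \<Phi> (Suc k) + 1 + \<rho>"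
      have death: "wp W death G \<tau>' u"
        if "\<rho>' \<le> \<tau>'"
          and ag2: "agree {rI, rKept, rDead, rP, rC, rB, rBest, rRoot, rTwoK, rNext} {aLive, aDead, aBnd} s' u"
          and post: "reg u rKept = length kept" "seg (arr u aLive) 0 kept"
            "reg u rDead = length ds + length new" "seg (arr u aDead) 0 (ds @ new)"
            "\<And>p. p \<in> set xs \<Longrightarrow> bound (Suc k) p (arr u aBnd p)"
          and best: "if \<exists>p\<in>set xs. att (Suc k) p
            then reg u rBest = Suc k \<and> reg u rRoot \<in> set xs \<and> att (Suc k) (reg u rRoot)
            else reg u rBest = reg s' rBest \<and> reg u rRoot = reg s' rRoot" for \<tau>' u
      proof -
        have loop: "wp W death_loop (wp W (Add rK (Reg rK) (Const 1)) G) (\<tau>' - 1) (set_reg rLive (length kept) u)"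
        proof (rule death_loop)
          show "static (set_reg rLive (length kept) u)"
            using static_agree[OF ag2] st' by simp
          show "seg (arr (set_reg rLive (length kept) u) aDead) 0 (ds @ new)" using post(4) by simp
          show "distinct (ds @ new)" by fact
          show "set (ds @ new) \<subseteq> {..<n}" using dsn(2) by auto
          show "reg (set_reg rLive (length kept) u) rDone = length ds" using J agree_reg[OF ag2] by simp
          show "reg (set_reg rLive (length kept) u) rDead = length (ds @ new)" using post(3) by simp
          show "recorded (nbrs_in ds) (set_reg rLive (length kept) u)"
            by (rule recorded_arr[of _ s']) (use J agree_arr[OF ag2] in auto)
          show "sum_list (map (\<lambda>p. 10 * deg p + 10) new) + 1 + (\<Phi> (Suc k) + 2 + \<rho>) \<le> \<tau>' - 1"
            using \<open>\<rho>' \<le> \<tau>'\<close> unfolding \<rho>'_def by linarith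
          fix \<tau>'' v
          assume fin: "\<Phi> (Suc k) + 2 + \<rho> \<le> \<tau>''"
            and ag3: "agree {rP, rDone, rE, rO, rF, rC, rQ} {aCnt, aSort} (set_reg rLive (length kept) u) v"
            and finished: "reg v rDone = length (ds @ new)" "recorded (nbrs_in (ds @ new)) v"
          have "agree ?X ?Y s u" by (rule agree_trans[OF ag ag2]) auto
          then have "agree ?X ?Y s (set_reg rLive (length kept) u)" by simp
          then have ag4: "agree ?X ?Y s v" by (rule agree_trans[OF _ ag3]) auto
          have v: "reg v rK = k" "reg v rLive = length kept" "reg v rDead = length ds + length new"
            "reg v rBest = reg u rBest" "reg v rRoot = reg u rRoot" "arr v aLive = arr u aLive"
            "arr v aDead = arr u aDead" "arr v aBnd = arr u aBnd"
            using J agree_reg[OF ag2] agree_reg[OF ag3] agree_arr[OF ag3] post by auto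
          have bnd: "\<forall>p\<in>live (Suc k). bound (Suc k) p (arr u aBnd p)"
            using post(5) J live_Suc[of k] by auto
          have best': "reg u rRoot < n \<and> att (reg u rBest) (reg u rRoot) \<and>
            (\<forall>j p. j \<le> Suc k \<longrightarrow> p < n \<longrightarrow> att j p \<longrightarrow> j \<le> reg u rBest)"
          proof (cases "\<exists>p\<in>set xs. att (Suc k) p")
            case True
            then have "reg u rBest = Suc k" "reg u rRoot \<in> live k" "att (Suc k) (reg u rRoot)"
              using best J by auto
            then show ?thesis by (auto simp: live_def)
          next
            case False
            then have same: "reg u rBest = reg s' rBest" "reg u rRoot = reg s' rRoot" using best by auto
            have "\<not> att (Suc k) q" if "q < n" for q
              using False J that attains_Suc_robust[of N k q] by (auto simp: live_def)
            then show ?thesis using J unfolding same by (metis le_Suc_eq)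
          qed
          have kW: "Suc k \<le> W" using k2 word by linarith
          have "G (\<tau>'' - 1) (set_reg rK (Suc k) v)"
            unfolding G_def
            using ag4 v finished kept dsn srt bnd best' fin post(2,4) by (simp del: seg_append set_append distinct_append)
          then show "wp W (Add rK (Reg rK) (Const 1)) G \<tau>'' v"
            using v(1) fin kW by simp
        qed
        have "length kept \<le> length xs" unfolding kept_def by (rule length_filter_le)
        then have "length kept \<le> W" using lens word by linarith
        then show ?thesis
          unfolding death_def using loop post(1) \<open>\<rho>' \<le> \<tau>'\<close> unfolding \<rho>'_def by simp
      qed
      define scan where "scan = scan_loop ;; death"
      have scan: "wp W scan G \<tau>' u"
        if "20 * length xs + 1 + \<rho>' \<le> \<tau>'" and ag1: "agree {rI, rKept, rTwoK, rNext} {} s' u"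
          and "reg u rI = 0" "reg u rKept = 0" "reg u rTwoK = 2 * k" "reg u rNext = 2 * k + 2" for \<tau>' u
        unfolding scan_def wp_Seq
      proof (rule scan_loop[where k = k and xs = xs and ds = ds and \<rho> = \<rho>'])
        have same: "arr u = arr s'" using agree_arr[OF ag1] by auto
        show "static u" using static_agree[OF ag1] st' by simp
        show "arr u aCnt q = nbrs_rob k q" if "q < n" for q
          using J that nbrs_rob_complement[of ds k q] by (auto simp: recorded_def same)
        show "reg u rLive = length xs" "reg u rK = k" "reg u rDead = length ds"
          using J agree_reg[OF ag1] by auto
        fix \<tau>'' v
        assume fin: "\<rho>' \<le> \<tau>''"
          "agree {rI, rKept, rDead, rP, rC, rB, rBest, rRoot} {aLive, aDead, aBnd} u v"
          "reg v rKept = length (filter (rob (Suc k)) xs)"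
          "seg (arr v aLive) 0 (filter (rob (Suc k)) xs)"
          "reg v rDead = length ds + length (filter (\<lambda>p. \<not> rob (Suc k) p) xs)"
          "seg (arr v aDead) 0 (ds @ filter (\<lambda>p. \<not> rob (Suc k) p) xs)"
          "\<And>p. p \<in> set xs \<Longrightarrow> bound (Suc k) p (arr v aBnd p)"
          "if \<exists>p\<in>set xs. att (Suc k) p
            then reg v rBest = Suc k \<and> reg v rRoot \<in> set xs \<and> att (Suc k) (reg v rRoot)
            else reg v rBest = reg u rBest \<and> reg v rRoot = reg u rRoot"
        have "agree {rI, rKept, rDead, rP, rC, rB, rBest, rRoot, rTwoK, rNext} {aLive, aDead, aBnd} s' v"
          by (rule agree_trans[OF ag1 fin(2)]) auto
        moreover have "reg u rBest = reg s' rBest" "reg u rRoot = reg s' rRoot"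
          using agree_reg[OF ag1] by auto
        ultimately show "wp W death G \<tau>'' v"
          using fin unfolding kept_def new_def by (intro death) (simp_all add: kept_def new_def del: seg_append)
      qed (use J that k2 lens agree_arr[OF ag1] in \<open>auto simp: live_def\<close>)
      have "\<Phi> k + 1 + \<rho> \<le> \<tau>" "reg s' rK = k" using J by auto
      then have "wp W ?body G (\<tau> - 1) s'"
        unfolding death_def[symmetric] scan_def[symmetric]
        using k2 word pot len1 by (simp, intro conjI scan) (simp_all add: \<rho>'_def)
      then show "wp W ?body ?I (\<tau> - 1) s'"
        unfolding G_def by (rule wp_mono) (rule I) }
  qed
qed

end

section \<open>Distributing the labels from the root\<close>

text \<open>What the deletion phase provides: sorted neighbour lists and a root for label \<open>K\<close>.\<close>
locale rooted_adjacency = adjacency +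
  fixes nbrs :: "nat \<Rightarrow> nat list" and root K :: nat
  assumes set_nbrs: "q < n \<Longrightarrow> set (nbrs q) = N q"
    and distinct_nbrs: "q < n \<Longrightarrow> distinct (nbrs q)"
    and sorted_nbrs: "q < n \<Longrightarrow> sorted_wrt (\<lambda>a b. less_robust b a) (nbrs q)"
    and root: "root < n" "att K root"
begin

definition children :: "nat \<Rightarrow> nat \<Rightarrow> nat \<Rightarrow> nat list" where
  "children u l p = take (2 * l) (filter (\<lambda>c. c \<noteq> p) (nbrs u))"

text \<open>
  The state of the search: the vertices in the queue \<open>qs\<close> have a label, and the first \<open>h\<close> of them
  have been served. Parent pointers lead to the root, which is what excludes that a vertex enters
  the queue again. The last but one condition says that a vertex can be served by its neighbours
  other than its parent; it is the robustness of the vertex that makes it true.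
\<close>
definition partial_labelling :: "nat list \<Rightarrow> nat \<Rightarrow> (nat \<Rightarrow> nat) \<Rightarrow> (nat \<Rightarrow> nat) \<Rightarrow> bool" where
  "partial_labelling qs h lab par \<longleftrightarrow>
     distinct qs \<and> set qs \<subseteq> {..<n} \<and> h \<le> length qs \<and> root \<in> set qs \<and>
     lab root = K \<and> par root = n \<and> (\<forall>x. x \<notin> set qs \<longrightarrow> lab x = 0) \<and>
     (\<forall>x\<in>set qs. x \<noteq> root \<longrightarrow> par x \<in> set (take h qs) \<and> x \<in> N (par x)) \<and>
     (\<forall>x\<in>set qs. (x, root) \<in> {(y, par y) |y. y \<in> set qs \<and> y \<noteq> root}\<^sup>*) \<and>
     (\<forall>x\<in>set qs. \<forall>i<lab x. 2 * (lab x - i) \<le> card {c \<in> N x. rob i c \<and> c \<noteq> par x}) \<and>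
     (\<forall>x\<in>set (take h qs). \<forall>i<lab x. 2 \<le> card {c \<in> N x. c \<in> set qs \<and> lab c = i})"

lemma partial_labelling_start:
  assumes "lab root = K" "par root = n" "\<And>x. x \<noteq> root \<Longrightarrow> lab x = 0"
  shows "partial_labelling [root] 0 lab par"
proof -
  have "2 * (K - i) \<le> card {c \<in> N root. rob i c \<and> c \<noteq> n}" if "i < K" for i
  proof -
    have "{c \<in> N root. rob i c \<and> c \<noteq> n} = {c \<in> N root. rob i c}"
      using adj_range[OF root(1)] by blast
    then show ?thesis using root(2) that by (simp add: attains_def)
  qed
  then show ?thesis
    unfolding partial_labelling_def using assms root(1) by simp
qed

text \<open>If an entry of a list sorted by decreasing robustness fails, so do all later ones.\<close>
lemma robust_nth:
  assumes "sorted_wrt (\<lambda>a b. less_robust b a) xs" "m < card {c \<in> set xs. rob i c}" "m < length xs"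
  shows "rob i (xs ! m)"
proof (rule ccontr)
  assume not: "\<not> rob i (xs ! m)"
  have "{c \<in> set xs. rob i c} \<subseteq> set (take m xs)"
  proof
    fix c assume "c \<in> {c \<in> set xs. rob i c}"
    then obtain j where j: "j < length xs" "c = xs ! j" "rob i (xs ! j)" by (auto simp: in_set_conv_nth)
    have "j < m"
    proof (rule ccontr)
      assume "\<not> j < m"
      then consider "j = m" | "m < j" by linarith
      then show False
      proof cases
        case 2
        then have "less_robust (xs ! j) (xs ! m)" using assms(1) j(1) by (simp add: sorted_wrt_iff_nth_less)
        then show False using j(3) not by (simp add: less_robust_def)
      qed (use j not in simp)
    qed
    then show "c \<in> set (take m xs)" using j assms(3) by (auto simp: in_set_conv_nth)
  qed
  then have "card {c \<in> set xs. rob i c} \<le> card (set (take m xs))" by (intro card_mono) auto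
  also have "\<dots> \<le> m" using card_length[of "take m xs"] by simp
  finally show False using assms(2) by simp
qed

context
  fixes qs h lab par u l cs
  assumes pl: "partial_labelling qs h lab par" and h: "h < length qs"
    and u: "u = qs ! h" and l: "l = lab u" and cs: "cs = children u l (par u)"
begin

lemma u_queue: "u \<in> set qs" "u < n" "u \<notin> set (take h qs)"
proof -
  have d: "distinct qs" "set qs \<subseteq> {..<n}" using pl by (simp_all add: partial_labelling_def)
  show "u \<in> set qs" using h u by simp
  then show "u < n" using d by blast
  show "u \<notin> set (take h qs)"
    using d(1) h u by (auto simp: in_set_conv_nth nth_eq_iff_index_eq)
qed

lemma available: "i < l \<Longrightarrow> 2 * (l - i) \<le> card {c \<in> N u. rob i c \<and> c \<noteq> par u}"
  using pl u_queue(1) unfolding partial_labelling_def l by blast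

lemma enough_children: "2 * l \<le> length (filter (\<lambda>c. c \<noteq> par u) (nbrs u))"
proof (cases "l = 0")
  case False
  then have "2 * (l - 0) \<le> card {c \<in> N u. rob 0 c \<and> c \<noteq> par u}" by (intro available) simp
  also have "{c \<in> N u. rob 0 c \<and> c \<noteq> par u} = set (filter (\<lambda>c. c \<noteq> par u) (nbrs u))"
    using set_nbrs[OF u_queue(2)] by auto
  also have "card \<dots> \<le> length (filter (\<lambda>c. c \<noteq> par u) (nbrs u))" by (rule card_length)
  finally show ?thesis by simp
qed simp

lemma length_children: "length cs = 2 * l"
  unfolding cs children_def using enough_children by simp

lemma distinct_children: "distinct cs"
  unfolding cs children_def using distinct_nbrs[OF u_queue(2)] by simp

lemma children_nbrs: "c \<in> set cs \<Longrightarrow> c \<in> N u \<and> c \<noteq> par u"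
proof -
  assume "c \<in> set cs"
  then have "c \<in> set (filter (\<lambda>c. c \<noteq> par u) (nbrs u))"
    unfolding cs children_def by (rule in_set_takeD)
  then show ?thesis using set_nbrs[OF u_queue(2)] by simp
qed

text \<open>
  The label \<open>i\<close> of the child number \<open>m\<close> satisfies \<open>m < 2 * (l - i)\<close>, and so many neighbours other
  than the parent are robust at level \<open>i\<close>; being sorted, they come first.
\<close>
lemma children_robust: "m < 2 * l \<Longrightarrow> rob ((2 * l - 1 - m) div 2) (cs ! m)"
proof -
  assume m: "m < 2 * l"
  define i where "i = (2 * l - 1 - m) div 2"
  let ?F = "filter (\<lambda>c. c \<noteq> par u) (nbrs u)"
  have "i < l" using m unfolding i_def by linarith
  have "m < 2 * (l - i)" using m unfolding i_def by linarith
  also have "\<dots> \<le> card {c \<in> N u. rob i c \<and> c \<noteq> par u}" using \<open>i < l\<close> by (rule available)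
  also have "{c \<in> N u. rob i c \<and> c \<noteq> par u} = {c \<in> set ?F. rob i c}"
    using set_nbrs[OF u_queue(2)] by auto
  finally have "rob i (?F ! m)"
    using sorted_nbrs[OF u_queue(2)] m enough_children
    by (intro robust_nth) (auto intro: sorted_wrt_filter)
  then show ?thesis unfolding i_def cs children_def using m by simp
qed

text \<open>
  If a child \<open>c\<close> of \<open>u\<close> were in the queue already, the parent pointers would lead from both \<open>u\<close> and
  \<open>c\<close> to the root. The edge between \<open>u\<close> and \<open>c\<close> is not among these pointers: \<open>c\<close> is not the parent of
  \<open>u\<close>, and \<open>u\<close> has not served anybody yet. So the edge could be bypassed.
\<close>
lemma children_fresh: "c \<in> set cs \<Longrightarrow> c \<notin> set qs"
proof
  assume c: "c \<in> set cs" "c \<in> set qs"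
  let ?R = "{(x, y). x < n \<and> y \<in> N x \<and> {x, y} \<noteq> {u, c}}"
  have cu: "c \<in> N u" "c \<noteq> par u" using children_nbrs[OF c(1)] by simp_all
  have step: "(y, par y) \<in> ?R" if "y \<in> set qs" "y \<noteq> root" for y
  proof -
    have y: "y < n" "par y \<in> set (take h qs)" "y \<in> N (par y)"
      using pl that unfolding partial_labelling_def by auto
    have "par y < n" using y(2) pl by (auto simp: partial_labelling_def dest: in_set_takeD)
    then have "par y \<in> N y" using adj_sym y(3) by blast
    moreover have "{y, par y} \<noteq> {u, c}" using cu(2) y(2) u_queue(3) by (auto simp: doubleton_eq_iff)
    ultimately show ?thesis using y(1) by simp
  qed
  have "{(y, par y) |y. y \<in> set qs \<and> y \<noteq> root} \<subseteq> ?R" using step by blast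
  then have reach: "(x, root) \<in> ?R\<^sup>*" if "x \<in> set qs" for x
    using pl that rtrancl_mono unfolding partial_labelling_def by blast
  have "sym ?R" unfolding sym_def using adj_sym adj_range by (auto simp: insert_commute)
  then have "sym (?R\<^sup>*)" by (rule sym_rtrancl)
  then have "(root, c) \<in> ?R\<^sup>*" using reach[OF c(2)] by (auto dest: symD)
  then have "(u, c) \<in> ?R\<^sup>*" using reach[OF u_queue(1)] by (rule rtrancl_trans[rotated])
  then show False using separates[OF u_queue(2) cu(1)] by simp
qed

lemma queue_fits: "length qs + 2 * l \<le> n"
proof -
  have "set cs \<subseteq> {..<n}" using children_nbrs adj_range[OF u_queue(2)] by blast
  then have "set (qs @ cs) \<subseteq> {..<n}" using pl by (simp add: partial_labelling_def)
  moreover have "distinct (qs @ cs)"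
    using pl distinct_children children_fresh by (auto simp: partial_labelling_def)
  ultimately have "length (qs @ cs) \<le> card {..<n}"
    by (metis card_mono distinct_card finite_lessThan)
  then show ?thesis using length_children by simp
qed

text \<open>
  A child that receives label \<open>i\<close> is robust at level \<open>i\<close>; without its parent it keeps just the
  neighbours that it needs to be served in turn. Vertices served earlier are unaffected, since the
  children are new to the queue.
\<close>
lemma partial_labelling_step:
  assumes lab': "\<And>i. i < 2 * l \<Longrightarrow> lab' (cs ! i) = (2 * l - 1 - i) div 2"
      "\<And>x. x \<notin> set cs \<Longrightarrow> lab' x = lab x"
    and par': "\<And>x. x \<in> set cs \<Longrightarrow> par' x = u" "\<And>x. x \<notin> set cs \<Longrightarrow> par' x = par x"
  shows "partial_labelling (qs @ cs) (Suc h) lab' par'"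
proof -
  have old: "lab' x = lab x" "par' x = par x" if "x \<in> set qs" for x
    using that children_fresh lab'(2) par'(2) by blast+
  have take_Suc: "take (Suc h) (qs @ cs) = take h qs @ [u]"
    using h u by (simp add: take_Suc_conv_app_nth)
  have root_qs: "root \<in> set qs" using pl by (simp add: partial_labelling_def)
  have cs_n: "set cs \<subseteq> {..<n}" using children_nbrs adj_range[OF u_queue(2)] by blast
  have parents: "par' x \<in> set (take (Suc h) (qs @ cs)) \<and> x \<in> N (par' x)"
    if "x \<in> set (qs @ cs)" "x \<noteq> root" for x
  proof (cases "x \<in> set cs")
    case True
    then show ?thesis using par'(1) children_nbrs unfolding take_Suc by simp
  next
    case False
    then have "x \<in> set qs" using that by simp
    then show ?thesis
      using pl that(2) old(2) unfolding take_Suc partial_labelling_def by auto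
  qed
  let ?R = "{(y, par y) |y. y \<in> set qs \<and> y \<noteq> root}"
  let ?R' = "{(y, par' y) |y. y \<in> set (qs @ cs) \<and> y \<noteq> root}"
  have "?R \<subseteq> ?R'" using old(2) by force
  then have reach_old: "(x, root) \<in> ?R'\<^sup>*" if "x \<in> set qs" for x
    using pl that rtrancl_mono unfolding partial_labelling_def by blast
  have reach: "(x, root) \<in> ?R'\<^sup>*" if "x \<in> set (qs @ cs)" for x
  proof (cases "x \<in> set cs")
    case True
    then have "x \<noteq> root" using children_fresh root_qs by blast
    then have "(x, u) \<in> ?R'" using True par'(1) by force
    then show ?thesis using reach_old[OF u_queue(1)] by (rule converse_rtrancl_into_rtrancl)
  qed (use that reach_old in simp)
  have capacity: "2 * (lab' x - i) \<le> card {c \<in> N x. rob i c \<and> c \<noteq> par' x}"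
    if "x \<in> set (qs @ cs)" "i < lab' x" for x i
  proof (cases "x \<in> set cs")
    case True
    then obtain m where m: "m < 2 * l" "x = cs ! m" using length_children by (auto simp: in_set_conv_nth)
    have "rob (lab' x) x" using children_robust[OF m(1)] lab'(1)[OF m(1)] m(2) by simp
    then have "2 * (lab' x - i) + 1 \<le> card {c \<in> N x. rob i c}" using that(2) by (rule robustD)
    also have "\<dots> \<le> card (insert u {c \<in> N x. rob i c \<and> c \<noteq> u})" by (intro card_mono) auto
    also have "\<dots> \<le> card {c \<in> N x. rob i c \<and> c \<noteq> u} + 1" by (simp add: card_insert_if)
    finally show ?thesis using par'(1)[OF True] by simp
  next
    case False
    then have "x \<in> set qs" using that by simp
    then show ?thesis using pl that(2) old unfolding partial_labelling_def by simp
  qed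
  have served: "2 \<le> card {c \<in> N x. c \<in> set (qs @ cs) \<and> lab' c = i}"
    if "x \<in> set (take (Suc h) (qs @ cs))" "i < lab' x" for x i
  proof (cases "x = u")
    case True
    then have i: "i < l" using that(2) old(1) u_queue(1) l by simp
    \<comment> \<open>Counted from the last child, the children number \<open>2 * i\<close> and \<open>2 * i + 1\<close> have label \<open>i\<close>.\<close>
    define a where "a = 2 * l - 1 - 2 * i"
    define b where "b = 2 * l - 2 - 2 * i"
    have ab: "a < 2 * l" "b < 2 * l" "a \<noteq> b" "(2 * l - 1 - a) div 2 = i" "(2 * l - 1 - b) div 2 = i"
      using i unfolding a_def b_def by linarith+
    have "card {cs ! a, cs ! b} = 2"
      using ab(1-3) length_children distinct_children by (simp add: nth_eq_iff_index_eq)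
    moreover have "{cs ! a, cs ! b} \<subseteq> {c \<in> N x. c \<in> set (qs @ cs) \<and> lab' c = i}"
      using ab lab'(1) length_children children_nbrs True by auto
    ultimately show ?thesis
      using card_mono[of "{c \<in> N x. c \<in> set (qs @ cs) \<and> lab' c = i}" "{cs ! a, cs ! b}"] by simp
  next
    case False
    then have x: "x \<in> set (take h qs)" using that(1) unfolding take_Suc by simp
    then have "lab' x = lab x" using old(1) by (auto dest: in_set_takeD)
    then have "2 \<le> card {c \<in> N x. c \<in> set qs \<and> lab c = i}"
      using pl x that(2) unfolding partial_labelling_def by simp
    also have "\<dots> \<le> card {c \<in> N x. c \<in> set (qs @ cs) \<and> lab' c = i}"
      by (intro card_mono) (use old(1) in auto)
    finally show ?thesis .
  qed
  have basics: "distinct (qs @ cs)" "set (qs @ cs) \<subseteq> {..<n}" "lab' root = K" "par' root = n"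
    using pl distinct_children children_fresh cs_n old[OF root_qs]
    unfolding partial_labelling_def by auto
  have unlab: "lab' x = 0" if "x \<notin> set (qs @ cs)" for x
    using pl that lab'(2) unfolding partial_labelling_def by simp
  show ?thesis
    unfolding partial_labelling_def
    using basics h root_qs unlab parents reach capacity served by (intro conjI ballI allI impI) auto
qed

end

text \<open>Vertices that were never reached have label 0 and demand nothing.\<close>
lemma partial_labelling_final:
  assumes "partial_labelling qs (length qs) lab par"
  shows "two_transitive_labelling {..<n} N lab"
  unfolding two_transitive_labelling_def
proof (intro ballI allI impI)
  fix x i assume "x \<in> {..<n}" "i < lab x"
  then have "x \<in> set qs" using assms by (auto simp: partial_labelling_def)
  then have "2 \<le> card {c \<in> N x. c \<in> set qs \<and> lab c = i}"
    using assms \<open>i < lab x\<close> by (simp add: partial_labelling_def)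
  also have "\<dots> \<le> card {c \<in> N x. lab c = i}" by (intro card_mono) auto
  finally show "2 \<le> card {c \<in> N x. lab c = i}" .
qed

lemma half_pred:
  fixes r :: nat
  assumes "0 < r"
  shows "r mod 2 = 0 \<Longrightarrow> r div 2 - 1 = (r - 1) div 2 \<and> (r - 1) mod 2 = 1"
    and "r mod 2 \<noteq> 0 \<Longrightarrow> r div 2 = (r - 1) div 2 \<and> (r - 1) mod 2 = 0"
  using assms by presburger+

text \<open>
  The loop does not run past the end of the block, because it stops after \<open>2 * l\<close> children and
  the block has that many entries other than the parent.
\<close>
lemma assign_loop:
  assumes uv: "u < n" "u \<le> W" "reg s rU = u" "reg s rE = off u" "reg s rPar = p"
    and regs: "reg s rR = 2 * l" "reg s rL = l" "reg s rOdd = 0" "reg s rTail = length qs"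
    and queue: "seg (arr s aQueue) 0 qs" and sorted: "seg (arr s aSort) (off u) (nbrs u)"
    and enough: "2 * l \<le> length (filter (\<lambda>c. c \<noteq> p) (nbrs u))"
    and fits: "length qs + 2 * l \<le> n" and credits: "20 * deg u + 1 + \<rho> \<le> \<tau>"
    and Q: "\<And>\<tau>' s'. \<rho> \<le> \<tau>' \<Longrightarrow>
      agree {rC, rE, rOdd, rL, rTail, rR} {aLab, aPar, aQueue} s s' \<Longrightarrow>
      reg s' rTail = length (qs @ children u l p) \<Longrightarrow> seg (arr s' aQueue) 0 (qs @ children u l p) \<Longrightarrow>
      (\<And>i. i < 2 * l \<Longrightarrow> arr s' aLab (children u l p ! i) = (2 * l - 1 - i) div 2) \<Longrightarrow>
      (\<And>x. x \<notin> set (children u l p) \<Longrightarrow> arr s' aLab x = arr s aLab x) \<Longrightarrow>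
      (\<And>x. x \<in> set (children u l p) \<Longrightarrow> arr s' aPar x = u) \<Longrightarrow>
      (\<And>x. x \<notin> set (children u l p) \<Longrightarrow> arr s' aPar x = arr s aPar x) \<Longrightarrow> Q \<tau>' s'"
  shows "wp W assign_loop Q \<tau> s"
proof -
  let ?J = "\<lambda>pre post m ch \<tau> s'. ch = filter (\<lambda>c. c \<noteq> p) pre \<and> m = length ch \<and> m \<le> 2 * l \<and>
    agree {rC, rE, rOdd, rL, rTail, rR} {aLab, aPar, aQueue} s s' \<and>
    reg s' rE = off u + length pre \<and> reg s' rR = 2 * l - m \<and> reg s' rL = (2 * l - m) div 2 \<and>
    reg s' rOdd = (2 * l - m) mod 2 \<and> reg s' rTail = length qs + m \<and>
    seg (arr s' aQueue) 0 (qs @ ch) \<and>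
    (\<forall>i<m. arr s' aLab (ch ! i) = (2 * l - 1 - i) div 2) \<and>
    (\<forall>x. x \<notin> set ch \<longrightarrow> arr s' aLab x = arr s aLab x) \<and>
    (\<forall>x\<in>set ch. arr s' aPar x = u) \<and> (\<forall>x. x \<notin> set ch \<longrightarrow> arr s' aPar x = arr s aPar x) \<and>
    20 * length post + 1 + \<rho> \<le> \<tau>"
  let ?I = "\<lambda>\<tau> s'. \<exists>pre post m ch. nbrs u = pre @ post \<and> ?J pre post m ch \<tau> s'"
  have len: "length (nbrs u) = deg u"
    using distinct_card[OF distinct_nbrs[OF uv(1)]] set_nbrs[OF uv(1)] card_N[OF uv(1)] by simp
  have I: "?I \<tau> v" if "nbrs u = pre @ post" "?J pre post m ch \<tau> v" for pre post m ch \<tau> v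
    using that by - (rule exI[of _ pre], rule exI[of _ post], rule exI[of _ m], rule exI[of _ ch], rule conjI)
  show ?thesis
    unfolding assign_loop_def
  proof (rule wp_While[where I = ?I])
    show "?I \<tau> s" by (rule I[of "[]" "nbrs u" "[]" 0]) (use assms len in simp_all)
    fix \<tau> s'
    assume "?I \<tau> s'"
    then obtain pre post m ch where split: "nbrs u = pre @ post" and J: "?J pre post m ch \<tau> s'"
      by (elim exE conjE) simp
    from J have ag: "agree {rC, rE, rOdd, rL, rTail, rR} {aLab, aPar, aQueue} s s'" by simp
    show "1 \<le> \<tau>" using J by simp
    have chs: "children u l p = ch" if "m = 2 * l"
      using J split that by (simp add: children_def)
    { assume "\<not> holds (Less (Const 0) (Reg rR)) s'"
      moreover have "reg s' rR = 2 * l - m" "m \<le> 2 * l" using J by blast+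
      ultimately have m: "m = 2 * l" by simp
      show "Q (\<tau> - 1) s'"
        using J m by (intro Q; elim conjE) (simp_all add: chs[OF m] del: seg_append) }
    { assume "holds (Less (Const 0) (Reg rR)) s'"
      moreover have "reg s' rR = 2 * l - m" using J by blast
      ultimately have m: "m < 2 * l" by simp
      then have "post \<noteq> []" using J split enough by auto
      then obtain c post' where post: "post = c # post'" by (cases post) auto
      have split': "nbrs u = (pre @ [c]) @ post'" using split post by simp
      have regs': "reg s' rU = u" "reg s' rPar = p" using uv agree_reg[OF ag] by simp_all
      have rd: "arr s' aSort (off u + length pre) = c"
        using sorted split post agree_arr[OF ag] by simp
      have c: "c < n" "c \<notin> set pre"
        using split post set_nbrs[OF uv(1)] distinct_nbrs[OF uv(1)] adj_range[OF uv(1)] by auto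
      have "length pre < deg u" using len split post by simp
      note bounds = word block_le[OF uv(1)] this
      have J1: "ch = filter (\<lambda>c. c \<noteq> p) pre" "m = length ch" "reg s' rE = off u + length pre"
        "reg s' rR = 2 * l - m" "reg s' rL = (2 * l - m) div 2" "reg s' rOdd = (2 * l - m) mod 2"
        "reg s' rTail = length qs + m" "21 + 20 * length post' + \<rho> \<le> \<tau>"
        using J post by auto
      have J2: "seg (arr s' aQueue) 0 (qs @ ch)" "\<forall>i<m. arr s' aLab (ch ! i) = (2 * l - 1 - i) div 2"
        "\<forall>x. x \<notin> set ch \<longrightarrow> arr s' aLab x = arr s aLab x" "\<forall>x\<in>set ch. arr s' aPar x = u"
        "\<forall>x. x \<notin> set ch \<longrightarrow> arr s' aPar x = arr s aPar x"
        using J by auto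
      let ?body = "Load rC aSort (Reg rE) ;; Add rE (Reg rE) (Const 1) ;;
         Cond (Equal (Reg rC) (Reg rPar)) Skip
          (Cond (Equal (Reg rOdd) (Const 0))
             (Assign rOdd (Const 1) ;; Sub rL (Reg rL) (Const 1))
             (Assign rOdd (Const 0)) ;;
           Store aLab (Reg rC) (Reg rL) ;; Store aPar (Reg rC) (Reg rU) ;;
           Store aQueue (Reg rTail) (Reg rC) ;; Add rTail (Reg rTail) (Const 1) ;;
           Sub rR (Reg rR) (Const 1))"
      define ch' where "ch' = filter (\<lambda>c. c \<noteq> p) (pre @ [c])"
      define G where "G = ?J (pre @ [c]) post' (length ch') ch'"
      have "wp W ?body G (\<tau> - 1) s'"
      proof (cases "c = p")
        case True
        then have "ch' = ch" using J1(1) by (simp add: ch'_def)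
        have G: "G \<tau>' v" if "agree {rC, rE} {} s' v" "reg v rE = Suc (off u + length pre)"
          "1 + 20 * length post' + \<rho> \<le> \<tau>'" for \<tau>' v
        proof -
          have "agree {rC, rE, rOdd, rL, rTail, rR} {aLab, aPar, aQueue} s v"
            by (rule agree_trans[OF ag that(1)]) auto
          moreover have "arr v = arr s'" "reg v rR = reg s' rR" "reg v rL = reg s' rL"
            "reg v rOdd = reg s' rOdd" "reg v rTail = reg s' rTail"
            using agree_reg[OF that(1)] agree_arr[OF that(1)] by auto
          ultimately show ?thesis
            unfolding G_def \<open>ch' = ch\<close> using J1 J2 that m ch'_def \<open>ch' = ch\<close> by (simp del: seg_append)
        qed
        show ?thesis
          using True J1(3,8) regs' rd c(1) bounds by (simp, intro conjI G) simp_all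
      next
        case False
        then have ch': "ch' = ch @ [c]" using J1(1) by (simp add: ch'_def)
        have c_ch: "c \<notin> set ch" using c(2) J1(1) by simp
        have G: "G \<tau>' v" if ag2: "agree {rC, rE, rOdd, rL, rTail, rR} {aLab, aPar, aQueue} s' v"
          and v: "reg v rE = Suc (off u + length pre)" "reg v rR = 2 * l - m - 1"
            "reg v rL = (2 * l - m - 1) div 2" "reg v rOdd = (2 * l - m - 1) mod 2"
            "reg v rTail = Suc (length qs + m)"
            "arr v aLab = (arr s' aLab)(c := (2 * l - m - 1) div 2)"
            "arr v aPar = (arr s' aPar)(c := u)"
            "arr v aQueue = (arr s' aQueue)(length qs + m := c)"
            "1 + 20 * length post' + \<rho> \<le> \<tau>'" for \<tau>' v
        proof -
          have "agree {rC, rE, rOdd, rL, rTail, rR} {aLab, aPar, aQueue} s v"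
            by (rule agree_trans[OF ag ag2]) auto
          moreover have "seg (arr v aQueue) 0 (qs @ ch @ [c])"
            unfolding v(8) using J2(1) J1(2) by simp
          moreover have "\<forall>i<Suc m. arr v aLab ((ch @ [c]) ! i) = (2 * l - 1 - i) div 2"
          proof (intro allI impI)
            fix i assume "i < Suc m"
            then consider "i < m" | "i = m" by linarith
            then show "arr v aLab ((ch @ [c]) ! i) = (2 * l - 1 - i) div 2"
            proof cases
              case 1
              then have "ch ! i \<noteq> c" using c_ch J1(2) by (metis nth_mem)
              then show ?thesis using 1 J1(2) J2(2) v(6) by (simp add: nth_append)
            next
              case 2
              then show ?thesis using J1(2) v(6) by (simp add: nth_append)
            qed
          qed
          ultimately show ?thesis
            unfolding G_def ch' using J1(2) J2 v m ch' ch'_def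
            by (simp del: seg_append add: ch'_def[symmetric])
        qed
        have "0 < 2 * l - m" using m by simp
        note odd = half_pred[OF this]
        have "2 * l \<le> W" and tail: "Suc (length qs + m) \<le> W"
          using fits m word by simp_all
        then have small: "2 * l - m \<le> W" by simp
        then have half: "(2 * l - m) div 2 \<le> W" by (rule order_trans[OF div_le_dividend])
        define r where "r = 2 * l - m - 1"
        define half_r where "half_r = (2 * l - m - 1) div 2"
        define odd_r where "odd_r = (2 * l - m - 1) mod 2"
        note G' = G[folded half_r_def odd_r_def, folded r_def]
        have R: "reg s' rR - 1 = r" "r \<le> W" using J1(4) small by (simp_all add: r_def)
        have L: "reg s' rL \<le> W" "half_r \<le> W" "reg s' rL - 1 \<le> W"
          using J1(5) half div_le_mono[of "2 * l - m - 1" "2 * l - m" 2] by (simp_all add: half_r_def)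
        note facts = False R L tail J1(3,7,8) regs' rd c(1) bounds uv(2)
        show ?thesis
        proof (cases "(2 * l - m) mod 2 = 0")
          case True
          then have "reg s' rOdd = 0" "reg s' rL - 1 = half_r" "odd_r = 1"
            using odd(1) J1(5,6) unfolding half_r_def odd_r_def by simp_all
          with facts show ?thesis
            by (simp, intro conjI G') simp_all
        next
          case odd': False
          then have "reg s' rOdd \<noteq> 0" "reg s' rL = half_r" "odd_r = 0"
            using odd(2) J1(5,6) unfolding half_r_def odd_r_def by simp_all
          with facts show ?thesis
            by (simp, intro conjI G') simp_all
        qed
      qed
      then show "wp W ?body ?I (\<tau> - 1) s'"
        unfolding G_def by (rule wp_mono) (rule I[OF split']) }
  qed
qed

end

context rooted_adjacency
begin

text \<open>
  A vertex enters the queue at most once, so its degree is charged at most once for serving it.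
\<close>
lemma queue_loop:
  assumes st: "static s" and regs: "reg s rHead = 0" "reg s rTail = 1"
    and start: "arr s aQueue 0 = root" "arr s aLab root = K" "arr s aPar root = n"
      "\<And>x. x \<noteq> root \<Longrightarrow> arr s aLab x = 0"
    and sorted: "\<And>u. u < n \<Longrightarrow> seg (arr s aSort) (off u) (nbrs u)"
    and credits: "(\<Sum>x<n. 20 * deg x + 20) + 1 + \<rho> \<le> \<tau>"
    and Q: "\<And>\<tau>' s'. \<rho> \<le> \<tau>' \<Longrightarrow>
      agree {rHead, rTail, rU, rL, rR, rOdd, rE, rPar, rC} {aLab, aPar, aQueue} s s' \<Longrightarrow>
      two_transitive_labelling {..<n} N (arr s' aLab) \<Longrightarrow> arr s' aLab root = K \<Longrightarrow> Q \<tau>' s'"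
  shows "wp W queue_loop Q \<tau> s"
proof -
  let ?X = "{rHead, rTail, rU, rL, rR, rOdd, rE, rPar, rC}"
  let ?Y = "{aLab, aPar, aQueue}"
  define \<Phi> where "\<Phi> qs h = (\<Sum>x\<in>{..<n} - set (take h qs). 20 * deg x + 20)" for qs h
  let ?J = "\<lambda>qs h \<tau> s'. agree ?X ?Y s s' \<and> reg s' rHead = h \<and> reg s' rTail = length qs \<and>
    seg (arr s' aQueue) 0 qs \<and> partial_labelling qs h (arr s' aLab) (arr s' aPar) \<and>
    \<Phi> qs h + 1 + \<rho> \<le> \<tau>"
  let ?I = "\<lambda>\<tau> s'. \<exists>qs h. ?J qs h \<tau> s'"
  have I: "?I \<tau> v" if "?J qs h \<tau> v" for qs h \<tau> v
    using that by - (rule exI[of _ qs], rule exI[of _ h])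
  let ?body = "Load rU aQueue (Reg rHead) ;; Add rHead (Reg rHead) (Const 1) ;;
     Load rL aLab (Reg rU) ;; Add rR (Reg rL) (Reg rL) ;; Assign rOdd (Const 0) ;;
     Load rE aOff (Reg rU) ;; Load rPar aPar (Reg rU) ;; assign_loop"
  show ?thesis
    unfolding queue_loop_def
  proof (rule wp_While[where I = ?I])
    have "partial_labelling [root] 0 (arr s aLab) (arr s aPar)"
      using start by (intro partial_labelling_start)
    then show "?I \<tau> s"
      by (intro I[of s 0 "[root]"]) (use regs start credits in \<open>simp add: \<Phi>_def\<close>)
    fix \<tau> s'
    assume "?I \<tau> s'"
    then obtain qs h where J: "?J qs h \<tau> s'" by (elim exE)
    from J have ag: "agree ?X ?Y s s'" and head: "reg s' rHead = h" "reg s' rTail = length qs"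
      and queue: "seg (arr s' aQueue) 0 qs"
      and pl: "partial_labelling qs h (arr s' aLab) (arr s' aPar)"
      and cred: "\<Phi> qs h + 1 + \<rho> \<le> \<tau>" by blast+
    have st': "static s'" using static_agree[OF ag] st by simp
    show "1 \<le> \<tau>" using cred by simp
    { assume "\<not> holds (Less (Reg rHead) (Reg rTail)) s'"
      then have "h = length qs" using head pl by (simp add: partial_labelling_def)
      then have "two_transitive_labelling {..<n} N (arr s' aLab)"
        using pl partial_labelling_final by simp
      moreover have "arr s' aLab root = K" using pl by (simp add: partial_labelling_def)
      moreover have "\<rho> \<le> \<tau> - 1" using cred by simp
      ultimately show "Q (\<tau> - 1) s'" using ag by (intro Q) }
    { assume "holds (Less (Reg rHead) (Reg rTail)) s'"
      then have h: "h < length qs" using head by simp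
      define u where "u = qs ! h"
      define l where "l = arr s' aLab u"
      define p where "p = arr s' aPar u"
      define cs where "cs = children u l p"
      note facts = pl h u_def l_def cs_def[unfolded p_def]
      have u: "u \<in> set qs" "u < n" "u \<notin> set (take h qs)" by (rule u_queue[OF facts])+
      have enough: "2 * l \<le> length (filter (\<lambda>c. c \<noteq> p) (nbrs u))"
        unfolding p_def by (rule enough_children[OF facts])
      have fits: "length qs + 2 * l \<le> n" by (rule queue_fits[OF facts])
      have p: "p \<le> n"
      proof (cases "u = root")
        case True
        then show ?thesis using pl unfolding p_def partial_labelling_def by simp
      next
        case False
        then have "p \<in> set (take h qs)" using pl u(1) unfolding p_def partial_labelling_def by blast
        then have "p \<in> set qs" by (rule in_set_takeD)
        then have "p < n" using pl unfolding partial_labelling_def by blast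
        then show ?thesis by simp
      qed
      have rd: "arr s' aQueue h = u" using queue h unfolding seg_def u_def by simp
      have pot: "\<Phi> (qs @ cs) (Suc h) + (20 * deg u + 20) \<le> \<Phi> qs h"
      proof -
        have t: "set (take (Suc h) (qs @ cs)) = insert u (set (take h qs))"
          using h by (simp add: take_Suc_conv_app_nth u_def)
        define R where "R = {..<n} - set (take (Suc h) (qs @ cs))"
        have R: "{..<n} - set (take h qs) = insert u R" "u \<notin> R" "finite R"
          unfolding R_def t using u by auto
        show ?thesis
          unfolding \<Phi>_def R(1) R_def[symmetric] by (subst sum.insert[OF R(3,2)]) simp
      qed
      define G where "G = ?J (qs @ cs) (Suc h)"
      have assign: "wp W assign_loop G \<tau>' v"
        if ag1: "agree {rU, rHead, rL, rR, rOdd, rE, rPar} {} s' v"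
          and v: "reg v rU = u" "reg v rE = off u" "reg v rPar = p" "reg v rR = 2 * l"
            "reg v rL = l" "reg v rOdd = 0" "reg v rHead = Suc h"
          and c: "20 * deg u + 1 + (\<Phi> (qs @ cs) (Suc h) + 1 + \<rho>) \<le> \<tau>'" for \<tau>' v
      proof -
        have same: "arr v = arr s'" "reg v rTail = length qs"
          using agree_arr[OF ag1] agree_reg[OF ag1] head by auto
        have "u \<le> W" using u(2) word by simp
        have agv: "agree ?X ?Y s v" by (rule agree_trans[OF ag ag1]) auto
        show ?thesis
        proof (rule assign_loop[OF u(2) \<open>u \<le> W\<close> v(1-6) same(2) _ _ enough fits c])
          show "seg (arr v aQueue) 0 qs" using queue same(1) by simp
          show "seg (arr v aSort) (off u) (nbrs u)"
            using sorted[OF u(2)] agree_arr[OF ag, of aSort] same(1) by simp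
          fix \<tau>'' w
          assume fin: "\<Phi> (qs @ cs) (Suc h) + 1 + \<rho> \<le> \<tau>''"
            "agree {rC, rE, rOdd, rL, rTail, rR} {aLab, aPar, aQueue} v w"
            "reg w rTail = length (qs @ children u l p)" "seg (arr w aQueue) 0 (qs @ children u l p)"
            "\<And>i. i < 2 * l \<Longrightarrow> arr w aLab (children u l p ! i) = (2 * l - 1 - i) div 2"
            "\<And>x. x \<notin> set (children u l p) \<Longrightarrow> arr w aLab x = arr v aLab x"
            "\<And>x. x \<in> set (children u l p) \<Longrightarrow> arr w aPar x = u"
            "\<And>x. x \<notin> set (children u l p) \<Longrightarrow> arr w aPar x = arr v aPar x"
          have "agree ?X ?Y s w" by (rule agree_trans[OF agv fin(2)]) auto
          moreover have "reg w rHead = Suc h" using agree_reg[OF fin(2)] v(7) by simp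
          moreover have "partial_labelling (qs @ cs) (Suc h) (arr w aLab) (arr w aPar)"
            by (rule partial_labelling_step[OF facts]) (use fin(5-8) same(1) in \<open>simp_all add: cs_def\<close>)
          ultimately show "G \<tau>'' w"
            unfolding G_def using fin(1,3,4) unfolding cs_def[symmetric] by blast
        qed
      qed
      have "2 * l \<le> W" using fits word by simp
      moreover have "20 * deg u + 20 + \<Phi> (qs @ cs) (Suc h) + 1 + \<rho> \<le> \<tau>" using pot cred by simp
      moreover have "Suc h \<le> W"
      proof -
        have "length qs \<le> n" using fits by simp
        then show ?thesis using h word by linarith
      qed
      moreover have "off u \<le> W" using off_le[of u] word by linarith
      ultimately have "wp W ?body G (\<tau> - 1) s'"
        using head rd u(2) p word static_off[OF st', of u] l_def[symmetric] p_def[symmetric]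
        by (simp, intro conjI assign) simp_all
      then show "wp W ?body ?I (\<tau> - 1) s'"
        unfolding G_def by (rule wp_mono) (rule I) }
  qed
qed

end

section \<open>Correctness and running time of the program\<close>

context adjacency
begin

lemma sum_deg: "(\<Sum>u<n. deg u) = length (concat adj)"
  by (simp add: length_concat sum_list_sum_nth atLeast0LessThan)

lemma program_correct:
  assumes credits: "\<tau> = 100 * (n + length (concat adj)) + 20"
  shows "\<exists>t s. exec W program (input_state adj) t s \<and> t \<le> \<tau> \<and>
    two_transitive_labelling {..<n} N (arr s aLab) \<and>
    (\<exists>root<n. arr s aLab root + 1 = reg s rOut) \<and>
    (\<forall>p<n. \<forall>k. attains N k p \<longrightarrow> k + 1 \<le> reg s rOut)"
proof -
  define Q where "Q = (\<lambda>(\<tau>' :: nat) (s :: state). two_transitive_labelling {..<n} N (arr s aLab) \<and>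
    (\<exists>root<n. arr s aLab root + 1 = reg s rOut) \<and>
    (\<forall>p<n. \<forall>k. attains N k p \<longrightarrow> k + 1 \<le> reg s rOut))"
  define s0 where "s0 = input_state adj"
  have zero: "reg s0 x = 0" if "x \<noteq> rN" for x
    using that by (simp add: s0_def input_state_def)
  have zero_lab: "arr s0 aLab = (\<lambda>_. 0)" by (simp add: s0_def input_state_def)
  have st0: "static s0" unfolding s0_def by (rule static_input)
  have n1: "0 < n" using nonempty by simp
  define c2 where "c2 = (\<Sum>x<n. 20 * deg x + 20) + 1 + (10 :: nat)"
  define c1 where "c1 = 40 * (\<Sum>p<n. deg p + 1) + (\<Sum>p<n. 10 * deg p + 10) + 1 + (c2 + 5)"
  have c2: "c2 = 20 * n + 20 * length (concat adj) + 11"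
    by (simp add: c2_def sum.distrib sum_distrib_left[symmetric] sum_deg)
  have c1: "c1 = 70 * n + 70 * length (concat adj) + 17"
  proof -
    have "(\<Sum>p<n. deg p + 1) = length (concat adj) + n" by (simp only: sum.distrib sum_deg) simp
    moreover have "(\<Sum>p<n. 10 * deg p + 10) = 10 * length (concat adj) + 10 * n"
      by (simp add: sum.distrib sum_distrib_left[symmetric] sum_deg)
    ultimately show ?thesis by (simp add: c1_def c2)
  qed
  define finish where "finish = Add rOut (Reg rBest) (Const 1)"
  define label where "label = (Store aQueue (Const 0) (Reg rRoot) ;; Store aLab (Reg rRoot) (Reg rBest) ;;
    Store aPar (Reg rRoot) (Reg rN) ;; Assign rTail (Const 1) ;; queue_loop ;; finish)"
  have prog: "program = init_loop ;; Assign rLive (Reg rN) ;; level_loop ;; label"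
    by (simp add: program_def label_def finish_def)
  have label: "wp W label Q \<tau>' s"
    if \<tau>': "c2 + 5 \<le> \<tau>'" and st: "static s" and heads: "reg s rHead = 0"
      and lab0: "arr s aLab = (\<lambda>_. 0)"
      and ds: "distinct ds" "set ds = {..<n}" "sorted_wrt less_robust ds" "recorded (nbrs_in ds) s"
      and r: "reg s rRoot < n" "att (reg s rBest) (reg s rRoot)"
      and best: "\<And>j p. p < n \<Longrightarrow> att j p \<Longrightarrow> j \<le> reg s rBest" for \<tau>' s ds
  proof -
    have set_l: "set (nbrs_in ds q) = N q" if "q < n" for q
      using ds(2) adj_range[OF that] by (auto simp: nbrs_in_def)
    have dist_l: "distinct (nbrs_in ds q)" for q
      using ds(1) by (simp add: nbrs_in_def)
    have len_l: "length (nbrs_in ds q) = deg q" if "q < n" for q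
      using distinct_card[OF dist_l] set_l[OF that] card_N[OF that] by metis
    interpret rooted_adjacency adj W "nbrs_in ds" "reg s rRoot" "reg s rBest"
    proof
      show "sorted_wrt (\<lambda>a b. less_robust b a) (nbrs_in ds q)" for q
        using ds(3) by (simp add: nbrs_in_def sorted_wrt_rev sorted_wrt_filter)
    qed (use set_l dist_l r in auto)
    have seg_l: "seg (arr s aSort) (off u) (nbrs_in ds u)" if "u < n" for u
    proof -
      have "seg (arr s aSort) (off u + (deg u - length (nbrs_in ds u))) (nbrs_in ds u)"
        using ds(4) that unfolding recorded_def by blast
      then show ?thesis using len_l[OF that] by simp
    qed
    have K: "2 * reg s rBest \<le> n"
    proof (cases "reg s rBest")
      case (Suc k)
      then have "2 * (reg s rBest - 0) \<le> card {q \<in> N (reg s rRoot). rob 0 q}"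
        using r(2)[unfolded attains_def, rule_format, of 0] by simp
      then show ?thesis using card_N[OF r(1)] deg_le[OF r(1)] Suc by simp
    qed simp
    define loop where "loop = queue_loop ;; finish"
    have loop: "wp W loop Q \<tau>'' v"
      if "c2 \<le> \<tau>''" "agree {rTail} {aQueue, aLab, aPar} s v" "reg v rTail = 1"
        "arr v aQueue 0 = reg s rRoot" "arr v aLab = (\<lambda>_. 0)(reg s rRoot := reg s rBest)"
        "arr v aPar (reg s rRoot) = n" for \<tau>'' v
      unfolding loop_def wp_Seq
    proof (rule queue_loop)
      show "static v" using static_agree[OF that(2)] st by simp
      show "reg v rHead = 0" using agree_reg[OF that(2)] heads by simp
      show "seg (arr v aSort) (off u) (nbrs_in ds u)" if "u < n" for u
        using seg_l[OF that] agree_arr[OF \<open>agree {rTail} {aQueue, aLab, aPar} s v\<close>, of aSort] by simp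
      show "(\<Sum>x<n. 20 * deg x + 20) + 1 + 10 \<le> \<tau>''" using that(1) by (simp add: c2_def)
      fix \<tau>3 :: nat and w :: state
      assume w: "10 \<le> \<tau>3" "agree {rHead, rTail, rU, rL, rR, rOdd, rE, rPar, rC} {aLab, aPar, aQueue} v w"
        "two_transitive_labelling {..<n} N (arr w aLab)" "arr w aLab (reg s rRoot) = reg s rBest"
      have "reg w rBest = reg s rBest" using agree_reg[OF w(2)] agree_reg[OF that(2)] by simp
      then show "wp W finish Q \<tau>3 w"
        using w K word r(1) best by (auto simp: finish_def Q_def)
    qed (use that in auto)
    have "reg s rBest \<le> W" "reg s rRoot \<le> W" "n \<le> W" using K r(1) word by simp_all
    then show ?thesis
      unfolding label_def loop_def[symmetric]
      using \<tau>' lab0 static_n[OF st] r(1) by (simp, intro conjI loop) simp_all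
  qed
  have levels: "wp W (level_loop ;; label) Q \<tau>' s"
    if "c1 \<le> \<tau>'" and ag: "agree {rI, rE, rF, rO, rC, rLive} {aCnt, aBnd, aLive} s0 s"
      and "reg s rLive = n"
      and init: "\<And>u. u < n \<Longrightarrow> arr s aCnt u = deg u \<and> arr s aBnd u = deg u \<and> arr s aLive u = u" for \<tau>' s
    unfolding wp_Seq
  proof (rule level_loop[where s = s and \<rho> = "c2 + 5"])
    show "static s" using static_agree[OF ag] st0 by simp
    show "reg s rK = 0" "reg s rDone = 0" "reg s rDead = 0" "reg s rBest = 0" "reg s rRoot = 0"
      using agree_reg[OF ag] zero by simp_all
    show "40 * (\<Sum>p<n. deg p + 1) + (\<Sum>p<n. 10 * deg p + 10) + 1 + (c2 + 5) \<le> \<tau>'"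
      using that(1) by (simp add: c1_def)
    fix \<tau>2 :: nat and v :: state and ds :: "nat list"
    assume v: "c2 + 5 \<le> \<tau>2"
      "agree {rI, rLive, rK, rTwoK, rNext, rKept, rDead, rDone, rP, rC, rB, rBest, rRoot, rE, rF, rQ, rO}
        {aCnt, aBnd, aLive, aDead, aSort} s v"
      "distinct ds" "set ds = {..<n}" "sorted_wrt less_robust ds" "recorded (nbrs_in ds) v"
      "reg v rRoot < n" "att (reg v rBest) (reg v rRoot)"
      "\<And>j p. p < n \<Longrightarrow> att j p \<Longrightarrow> j \<le> reg v rBest"
    show "wp W label Q \<tau>2 v"
    proof (rule label[OF v(1) _ _ _ v(3-9)])
      show "static v" using static_agree[OF v(2)] static_agree[OF ag] st0 by simp
      show "reg v rHead = 0" using agree_reg[OF v(2)] agree_reg[OF ag] zero by simp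
      show "arr v aLab = (\<lambda>_. 0)" using agree_arr[OF v(2)] agree_arr[OF ag] zero_lab by simp
    qed
  qed (use that in auto)
  define rest where "rest = level_loop ;; label"
  have "wp W (init_loop ;; Assign rLive (Reg rN) ;; rest) Q \<tau> s0"
    unfolding wp_Seq
  proof (rule init_loop[OF st0])
    show "reg s0 rI = 0" by (rule zero) simp
    show "10 * n + 1 + (c1 + 1) \<le> \<tau>" using credits by (simp add: c1)
    fix \<tau>' :: nat and s :: state
    assume s: "c1 + 1 \<le> \<tau>'" "agree {rI, rE, rF, rO, rC} {aCnt, aBnd, aLive} s0 s"
      "\<forall>u<n. arr s aCnt u = deg u \<and> arr s aBnd u = deg u \<and> arr s aLive u = u"
    have "agree {rI, rE, rF, rO, rC, rLive} {aCnt, aBnd, aLive} s0 s"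
      by (rule agree_trans[OF agree_refl s(2)]) auto
    moreover have "static s" using static_agree[OF s(2)] st0 by simp
    moreover have "n \<le> W" using word by simp
    ultimately show "wp W (Assign rLive (Reg rN)) (wp W rest Q) \<tau>' s"
      unfolding rest_def wp_Assign using s static_n[of s] by (auto simp del: wp_Seq intro!: levels)
  qed
  then show ?thesis unfolding prog rest_def wp_def Q_def s0_def by blast
qed

end

section \<open>Partitions as labellings of an enumerated tree\<close>

locale enumerated_tree =
  fixes V :: "'a set" and E :: "'a set set" and vs :: "'a list" and adj :: "nat list list"
  assumes tree: "tree V E" and lists: "adjacency_lists V E vs adj"
begin

abbreviation "n \<equiv> length adj"
abbreviation "N \<equiv> (\<lambda>u. set (adj ! u))"

lemma enumeration: "distinct vs" "set vs = V" "length vs = n" "card V = n"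
  using lists distinct_card[of vs] by (auto simp: adjacency_lists_def)

lemma N_eq: "i < n \<Longrightarrow> N i = {j. j < n \<and> {vs ! i, vs ! j} \<in> E}"
  using lists by (auto simp: adjacency_lists_def)

lemma index: assumes "v \<in> V" obtains i where "i < n" "vs ! i = v"
  using assms enumeration by (metis in_set_conv_nth)

lemma nth_eq_iff: "i < n \<Longrightarrow> j < n \<Longrightarrow> vs ! i = vs ! j \<longleftrightarrow> i = j"
  using enumeration by (simp add: nth_eq_iff_index_eq)

lemma nth_V: "i < n \<Longrightarrow> vs ! i \<in> V"
  using enumeration by (metis nth_mem)

lemma finite_E: "finite E"
proof -
  have "finite V" "E \<subseteq> Pow V" using tree by (auto simp: tree_def simple_graph_def)
  then show ?thesis by (meson finite_Pow_iff finite_subset)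
qed

text \<open>Each edge appears in two adjacency lists, once with the smaller number first.\<close>
lemma length_concat_le: "length (concat adj) \<le> 2 * card E"
proof -
  let ?A = "SIGMA i:{..<n}. N i"
  let ?g = "\<lambda>(i, j). ({vs ! i, vs ! j}, i < j)"
  have dist: "card (N i) = length (adj ! i)" if "i < n" for i
    using lists that enumeration(3) by (intro distinct_card) (simp add: adjacency_lists_def)
  have "length (concat adj) = (\<Sum>i<n. length (adj ! i))"
    by (simp add: length_concat sum_list_sum_nth atLeast0LessThan)
  also have "\<dots> = card ?A" by (simp add: dist)
  also have "\<dots> \<le> card (E \<times> (UNIV :: bool set))"
  proof (rule card_inj_on_le[of ?g])
    show "inj_on ?g ?A"
    proof (rule inj_onI, clarify)
      fix i j i' j'
      assume a: "i < n" "j \<in> N i" "i' < n" "j' \<in> N i'"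
        and eq: "{vs ! i, vs ! j} = {vs ! i', vs ! j'}" "(i < j) = (i' < j')"
      have "j < n" "j' < n" using a by (auto simp: N_eq)
      then have "i = i' \<and> j = j' \<or> i = j' \<and> j = i'"
        using eq(1) a(1,3) by (auto simp: doubleton_eq_iff nth_eq_iff)
      then show "i = i' \<and> j = j'" using eq(2) by auto
    qed
    show "?g ` ?A \<subseteq> E \<times> UNIV" by (auto simp: N_eq)
    show "finite (E \<times> (UNIV :: bool set))" using finite_E by simp
  qed
  also have "\<dots> = 2 * card E" by (simp add: card_cartesian_product)
  finally show ?thesis .
qed

lemma n_pos: "0 < n"
proof -
  have "V \<noteq> {}" using tree by (simp add: tree_def connected_graph_def)
  then show ?thesis using enumeration(1-3) by auto
qed

lemma adjacency: "3 * n + length (concat adj) + 10 \<le> W \<Longrightarrow> adjacency adj W"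
proof
  show "adj \<noteq> []" using n_pos by simp
next
  fix i assume i: "i < n"
  show "distinct (adj ! i)" using lists i enumeration(3) by (simp add: adjacency_lists_def)
  fix j assume j: "j \<in> N i"
  show "j < n" using i j by (simp add: N_eq)
  then show "i \<in> N j" using i j by (simp add: N_eq insert_commute)
  show "(i, j) \<notin> {(x, y). x < n \<and> y \<in> N x \<and> {x, y} \<noteq> {i, j}}\<^sup>*"
  proof
    let ?R = "{(x, y). x < n \<and> y \<in> N x \<and> {x, y} \<noteq> {i, j}}"
    let ?S = "{(x, y). {x, y} \<in> E \<and> {x, y} \<noteq> {vs ! i, vs ! j}}"
    have "(vs ! a, vs ! b) \<in> ?S\<^sup>*" if "(a, b) \<in> ?R\<^sup>*" for a b
      using that
    proof (induction rule: rtrancl_induct)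
      case (step y z)
      then have "y < n" "z < n" "{vs ! y, vs ! z} \<in> E" "{y, z} \<noteq> {i, j}" by (auto simp: N_eq)
      then have "(vs ! y, vs ! z) \<in> ?S"
        using i \<open>j < n\<close> by (auto simp: doubleton_eq_iff nth_eq_iff)
      then show ?case using step.IH by (rule rtrancl_into_rtrancl[rotated])
    qed simp
    moreover assume "(i, j) \<in> ?R\<^sup>*"
    ultimately have "(vs ! i, vs ! j) \<in> ?S\<^sup>*" by blast
    moreover have "{vs ! i, vs ! j} \<in> E" using i j by (simp add: N_eq)
    ultimately show False
      using tree acyclic_edge_separates[of V E "vs ! i" "vs ! j"] by (simp add: tree_def)
  qed
qed

text \<open>A vertex in the last part carries the label \<open>length P - 1\<close>, so it attains this label.\<close>
lemma partition_length_le: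
  assumes P: "two_transitive_partition V E P"
    and top: "\<forall>p<n. \<forall>k. attains N k p \<longrightarrow> k + 1 \<le> M"
  shows "length P \<le> M"
proof (cases "P = []")
  case False
  have part: "partition_on V (set P)" "distinct P"
    and dom: "\<And>i j. i < j \<Longrightarrow> j < length P \<Longrightarrow> two_dominates E (P ! i) (P ! j)"
    using P by (auto simp: two_transitive_partition_def)
  have uniq: "i = j" if "i < length P" "j < length P" "v \<in> P ! i" "v \<in> P ! j" for i j v
    using that part by (metis IntI disjointD empty_iff nth_eq_iff_index_eq nth_mem partition_onD2)
  have "\<exists>j. j < length P \<and> vs ! i \<in> P ! j" if "i < n" for i
    using nth_V[OF that] partition_onD1[OF part(1)] by (auto simp: in_set_conv_nth)
  then obtain f where f: "\<And>i. i < n \<Longrightarrow> f i < length P \<and> vs ! i \<in> P ! f i" by metis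
  have lab: "two_transitive_labelling {..<n} N f"
    unfolding two_transitive_labelling_def
  proof (intro ballI allI impI)
    fix i j assume i: "i \<in> {..<n}" and j: "j < f i"
    let ?A = "{u \<in> P ! j. {u, vs ! i} \<in> E}"
    have "2 \<le> card ?A"
      using dom[OF j] f[of i] i unfolding two_dominates_def by auto
    also have "\<dots> \<le> card {c \<in> N i. f c = j}"
    proof (rule surj_card_le[of _ _ "(!) vs"])
      show "?A \<subseteq> (!) vs ` {c \<in> N i. f c = j}"
      proof
        fix u assume u: "u \<in> ?A"
        have jl: "j < length P" using j f[of i] i by simp
        then have "u \<in> V" using u partition_onD1[OF part(1)] by auto
        then obtain c where c: "c < n" "vs ! c = u" by (rule index)
        have "f c = j" using uniq[of "f c" j u] f[OF c(1)] jl u c by simp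
        then show "u \<in> (!) vs ` {c \<in> N i. f c = j}"
          using u c i by (auto simp: N_eq insert_commute)
      qed
    qed simp
    finally show "2 \<le> card {c \<in> N i. f c = j}" .
  qed
  have last: "length P - 1 < length P" using False by simp
  then have "P ! (length P - 1) \<noteq> {}" using partition_onD3[OF part(1)] by (metis nth_mem)
  then obtain v where v: "v \<in> P ! (length P - 1)" by blast
  then have "v \<in> V" using partition_onD1[OF part(1)] last by (metis UnionI nth_mem)
  then obtain i where i: "i < n" "vs ! i = v" by (rule index)
  have "f i = length P - 1" using uniq[of "f i" "length P - 1" v] f[OF i(1)] last v i by simp
  moreover have "attains N (f i) i"
    by (rule labelled_attains[OF lab]) (use i in \<open>auto simp: N_eq insert_commute\<close>)
  ultimately show ?thesis using top i(1) last by fastforce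
qed simp

text \<open>No part is empty because the vertex with the largest label has neighbours of all smaller labels.\<close>
lemma labelling_partition:
  assumes lab: "two_transitive_labelling {..<n} N f"
    and root: "root < n" "f root + 1 = M" and top: "\<And>i. i < n \<Longrightarrow> f i < M"
  shows "two_transitive_partition V E (map (\<lambda>j. {vs ! i |i. i < n \<and> f i = j}) [0..<M])"
proof -
  define part where "part j = {vs ! i |i. i < n \<and> f i = j}" for j
  have mem: "vs ! i \<in> part j \<longleftrightarrow> f i = j" if "i < n" for i j
    using that nth_eq_iff by (auto simp: part_def)
  have nonempty: "part j \<noteq> {}" if "j < M" for j
  proof (cases "j = f root")
    case True
    then show ?thesis using mem[OF root(1)] by auto
  next
    case False
    then have "2 \<le> card {c \<in> N root. f c = j}"
      using lab that root by (simp add: two_transitive_labelling_def)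
    then obtain c where "c \<in> N root" "f c = j" by (metis (mono_tags, lifting) card.empty empty_Collect_eq not_numeral_le_zero)
    then show ?thesis using root(1) mem[of c j] by (auto simp: N_eq)
  qed
  have disj: "part i \<inter> part j = {}" if "i \<noteq> j" for i j
    using that nth_eq_iff by (auto simp: part_def)
  have inj: "inj_on part {..<M}"
    by (rule inj_onI) (metis disj inf.idem lessThan_iff nonempty)
  have "partition_on V (part ` {..<M})"
  proof (rule partition_onI)
    show "\<Union> (part ` {..<M}) = V"
    proof (intro equalityI subsetI)
      fix v assume "v \<in> V"
      then obtain i where "i < n" "vs ! i = v" by (rule index)
      then show "v \<in> \<Union> (part ` {..<M})" using mem[of i "f i"] top by auto
    qed (auto simp: part_def nth_V)
    show "disjnt p q" if pq: "p \<in> part ` {..<M}" "q \<in> part ` {..<M}" "p \<noteq> q" for p q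
    proof -
      obtain i j where "p = part i" "q = part j" "i \<noteq> j" using pq by blast
      then show ?thesis using disj by (simp add: disjnt_def)
    qed
    show "{} \<notin> part ` {..<M}" using nonempty by force
  qed
  moreover have "two_dominates E (part i) (part j)" if "i < j" for i j
    unfolding two_dominates_def
  proof
    fix v assume "v \<in> part j"
    then obtain a where a: "a < n" "v = vs ! a" "f a = j" by (auto simp: part_def)
    let ?C = "{c \<in> N a. f c = i}"
    have "2 \<le> card ?C" using lab a that by (simp add: two_transitive_labelling_def)
    also have "\<dots> = card ((!) vs ` ?C)"
      by (rule card_image[symmetric]) (use a in \<open>auto simp: inj_on_def N_eq nth_eq_iff\<close>)
    also have "\<dots> \<le> card {u \<in> part i. {u, v} \<in> E}"
    proof (rule card_mono)
      have "part i \<subseteq> V" by (auto simp: part_def nth_V)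
      moreover have "finite V" using enumeration by auto
      ultimately show "finite {u \<in> part i. {u, v} \<in> E}" by (simp add: finite_subset)
      show "(!) vs ` ?C \<subseteq> {u \<in> part i. {u, v} \<in> E}"
        using a by (auto simp: N_eq mem insert_commute)
    qed
    finally show "2 \<le> card {u \<in> part i. {u, v} \<in> E}" .
  qed
  ultimately show ?thesis
    unfolding two_transitive_partition_def part_def[symmetric]
    using inj by (simp add: distinct_map lessThan_atLeast0 inj_on_subset)
qed

lemma Tr2_eq:
  assumes "maximum_two_transitive_partition V E P"
  shows "length P = Tr2 V E"
proof -
  let ?S = "{length Q |Q. two_transitive_partition V E Q}"
  have "?S \<subseteq> {..length P}" "length P \<in> ?S"
    using assms by (auto simp: maximum_two_transitive_partition_def)
  then have "Max ?S = length P" by (intro Max_eqI) (auto intro: finite_subset)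
  then show ?thesis by (simp add: Tr2_def)
qed

end

section \<open>Maximum 2-transitive partitions of trees in linear time\<close>
theorem theorem21:
  shows "\<exists>(p :: com) (c :: nat) (d :: nat).
    \<forall>(V :: 'a set) (E :: 'a set set) (vs :: 'a list) (adj :: nat list list).
      tree V E \<and> adjacency_lists V E vs adj \<longrightarrow>
      (\<exists>t s. exec (d * (card V + card E)) p (input_state adj) t s \<and>
             t \<le> c * (card V + card E) \<and>
             maximum_two_transitive_partition V E (output_partition vs s) \<and>
             length (output_partition vs s) = Tr2 V E)"
proof (rule exI[of _ program], rule exI[of _ 220], rule exI[of _ 13], intro allI impI)
  fix V :: "'a set" and E :: "'a set set" and vs :: "'a list" and adj :: "nat list list"
  assume "tree V E \<and> adjacency_lists V E vs adj"
  then interpret T: enumerated_tree V E vs adj by unfold_locales simp_all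
  let ?W = "13 * (card V + card E)"
  \<comment> \<open>The adjacency lists have total length at most \<open>2 * card E\<close>, and additive constants are
    absorbed by \<open>card V\<close>, since a tree is not empty.\<close>
  have size: "card V = length adj" "0 < length adj" "length (concat adj) \<le> 2 * card E"
    using T.enumeration(4) T.n_pos T.length_concat_le by simp_all
  have arith: "3 * a + b + 10 \<le> 13 * (a + e)" "100 * (a + b) + 20 \<le> 220 * (a + e)"
    if "0 < a" "b \<le> 2 * e" for a b e :: nat
    using that by simp_all
  have "3 * length adj + length (concat adj) + 10 \<le> ?W"
    unfolding size(1) using size(2,3) by (rule arith(1))
  then interpret A: adjacency adj ?W by (rule T.adjacency)
  obtain t s where run: "exec ?W program (input_state adj) t s"
      "t \<le> 100 * (length adj + length (concat adj)) + 20"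
    and lab: "two_transitive_labelling {..<length adj} (\<lambda>u. set (adj ! u)) (arr s 2)"
    and root: "\<exists>root<length adj. arr s 2 root + 1 = reg s 1"
    and top: "\<forall>p<length adj. \<forall>k. attains (\<lambda>u. set (adj ! u)) k p \<longrightarrow> k + 1 \<le> reg s 1"
    using A.program_correct[OF refl] by blast
  have below: "arr s 2 i < reg s 1" if "i < length adj" for i
  proof -
    have "attains (\<lambda>u. set (adj ! u)) (arr s 2 i) i"
    proof (rule labelled_attains[OF lab])
      show "set (adj ! u) \<subseteq> {..<length adj}" if "u \<in> {..<length adj}" for u
        using A.adj_range[of u] that by auto
      show "u \<in> set (adj ! v)" if "u \<in> {..<length adj}" "v \<in> set (adj ! u)" for u v
        using A.adj_sym[of u v] that by simp
    qed (use that in simp_all)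
    then have "arr s 2 i + 1 \<le> reg s 1" using top that by blast
    then show ?thesis by simp
  qed
  have out: "output_partition vs s = map (\<lambda>j. {vs ! i |i. i < length adj \<and> arr s 2 i = j}) [0..<reg s 1]"
    by (simp add: output_partition_def T.enumeration(3))
  obtain root where "root < length adj" "arr s 2 root + 1 = reg s 1" using root by blast
  then have "two_transitive_partition V E (output_partition vs s)"
    unfolding out by (rule T.labelling_partition[OF lab _ _ below])
  moreover have "length Q \<le> length (output_partition vs s)" if "two_transitive_partition V E Q" for Q
    using T.partition_length_le[OF that top] by (simp add: out)
  ultimately have max: "maximum_two_transitive_partition V E (output_partition vs s)"
    by (simp add: maximum_two_transitive_partition_def)
  have "t \<le> 220 * (card V + card E)"
    unfolding size(1) by (rule order_trans[OF run(2) arith(2)[OF size(2,3)]])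
  with run(1) max T.Tr2_eq[OF max]
  show "\<exists>t s. exec ?W program (input_state adj) t s \<and> t \<le> 220 * (card V + card E) \<and>
      maximum_two_transitive_partition V E (output_partition vs s) \<and>
      length (output_partition vs s) = Tr2 V E"
    by (intro exI conjI)
qed

end
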